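(* Let $\beta=4\,\frac{p-1}{p}$ and let $0<c<1$. For any $\epsilon>0$, the origin $(0,0)$ is not a regular boundary point, for the equation $u_t=\mathcal{A}_pu$, of the domain enclosed by the hypersurfaces $$\{(x,t)\in\mathbb{R}^n\times(-\infty,0) : |x|^2=-\beta(1+\epsilon)t\log|\log|t||\}\quad\text{and}\quad\{t=-c\},$$ that is, of $\Omega=\{(x,t)\in\mathbb{R}^n\times(-c,0) : |x|^2<-\beta(1+\epsilon)t\log|\log|t||\}$.
   Context: Fix an integer $n\ge1$ and $1<p<\infty$. Points of $\mathbb{R}^n\times\mathbb{R}$ are written $\zeta=(x,t)$; $Du$ and $D^2u$ are the gradient and Hessian in the spatial variable $x$ only. $\partial\Omega$ is the Euclidean boundary of a domain $\Omega\subset\mathbb{R}^n\times(-\infty,\infty)$. The normalised $p$-parabolic equation is $u_t=\mathcal{A}_pu$, where, for $Du\neq0$, $$\mathcal{A}_pu=\frac1p|Du|^{2-p}\,\mathrm{div}(|Du|^{p-2}Du)=\frac1p\mathrm{tr}(D^2u)+\frac{p-2}{p}\left\langle D^2u\frac{Du}{|Du|},\frac{Du}{|Du|}\right\rangle .$$ Viscosity solutions. For a symmetric matrix $X$ let $\lambda(X)$ and $\Lambda(X)$ be its smallest and largest eigenvalues. A lower semicontinuous $u\in L^\infty(\Omega)$ is a viscosity supersolution in $\Omega$ if, whenever $\phi\in C^2(\Omega)$ and $u-\phi$ has a minimum at $\zeta_0\in\Omega$, one has $\phi_t(\zeta_0)-\mathcal{A}_p\phi(\zeta_0)\ge0$ if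 $D\phi(\zeta_0)\ne0$, and $\phi_t(\zeta_0)-\frac1p\mathrm{tr}(D^2\phi(\zeta_0))-\frac{p-2}{p}\lambda(D^2\phi(\zeta_0))\ge0$ if $D\phi(\zeta_0)=0$. An upper semicontinuous $u\in L^\infty(\Omega)$ is a viscosity subsolution in $\Omega$ if, whenever $\phi\in C^2(\Omega)$ and $u-\phi$ has a maximum at $\zeta_0\in\Omega$, one has $\phi_t(\zeta_0)-\mathcal{A}_p\phi(\zeta_0)\le0$ if $D\phi(\zeta_0)\ne0$, and $\phi_t(\zeta_0)-\frac1p\mathrm{tr}(D^2\phi(\zeta_0))-\frac{p-2}{p}\Lambda(D^2\phi(\zeta_0))\le0$ if $D\phi(\zeta_0)=0$. (These are the conditions for $p\ge2$; for $1<p<2$, $\lambda$ and $\Lambda$ are interchanged, so that at $D\phi=0$ the operator is always replaced by its lower semicontinuous envelope for supersolutions and its upper semicontinuous envelope for subsolutions.) Perron solution and regularity. For a bounded continuous $f:\partial\Omega\to\mathbb{R}$, let $\mathcal{L}_f$ be the class of viscosity subsolutions $v$ in $\Omega$ with $\limsup_{\eta\to\zeta}v(\eta)\le f(\zeta)$ for all $\zeta\in\partial\Omega$, and let $\underline{H}_f(\zeta)=\sup\{v(\zeta):v\in\mathcal{L}_f\}$ (lower Perron solution). A point $\zeta_0\in\partial\Omega$ is regular if $\lim_{\Omega\ni\zeta\to\zeta_0}\underline{H}_f(\zeta)=f(\zeta_0)$ for every bounded continuous $f:\partial\Omega\to\mathbb{R}$. *)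

theory Defs
  imports "HOL-Analysis.Analysis"
begin

section \<open>Spatial and time derivatives\<close>

text \<open>A space-time point is a pair \<open>(x, t)\<close> with \<open>x :: real ^ 'n\<close> and \<open>t :: real\<close>.
  The gradient and the Hessian below are taken in \<open>x\<close> only.\<close>

definition spatial_grad :: "((real ^ 'n) \<times> real \<Rightarrow> real) \<Rightarrow> (real ^ 'n) \<times> real \<Rightarrow> real ^ 'n" where
  "spatial_grad \<phi> \<zeta> = (THE D. GDERIV (\<lambda>y. \<phi> (y, snd \<zeta>)) (fst \<zeta>) :> D)"

definition spatial_hessian ::
    "((real ^ 'n) \<times> real \<Rightarrow> real) \<Rightarrow> (real ^ 'n) \<times> real \<Rightarrow> real ^ 'n ^ 'n" where
  "spatial_hessian \<phi> \<zeta> = jacobian (\<lambda>y. spatial_grad \<phi> (y, snd \<zeta>)) (at (fst \<zeta>))"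

definition time_deriv :: "((real ^ 'n) \<times> real \<Rightarrow> real) \<Rightarrow> (real ^ 'n) \<times> real \<Rightarrow> real" where
  "time_deriv \<phi> \<zeta> = deriv (\<lambda>s. \<phi> (fst \<zeta>, s)) (snd \<zeta>)"

text \<open>Twice continuously differentiable on an open set, jointly in all variables.\<close>

definition C2_on :: "'a::real_normed_vector set \<Rightarrow> ('a \<Rightarrow> real) \<Rightarrow> bool" where
  "C2_on S \<phi> \<longleftrightarrow>
    (\<exists>(\<phi>' :: 'a \<Rightarrow> 'a \<Rightarrow>\<^sub>L real) (\<phi>'' :: 'a \<Rightarrow> 'a \<Rightarrow>\<^sub>L 'a \<Rightarrow>\<^sub>L real).
      (\<forall>z\<in>S. (\<phi> has_derivative blinfun_apply (\<phi>' z)) (at z)) \<and>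
      (\<forall>z\<in>S. (\<phi>' has_derivative blinfun_apply (\<phi>'' z)) (at z)) \<and>
      continuous_on S \<phi>'')"


section \<open>The normalised p-parabolic operator\<close>

definition eigenvalues :: "real ^ 'n ^ 'n \<Rightarrow> real set" where
  "eigenvalues X = {l. \<exists>v. v \<noteq> 0 \<and> X *v v = l *\<^sub>R v}"

definition min_eigenvalue :: "real ^ 'n ^ 'n \<Rightarrow> real" where
  "min_eigenvalue X = Min (eigenvalues X)"

definition max_eigenvalue :: "real ^ 'n ^ 'n \<Rightarrow> real" where
  "max_eigenvalue X = Max (eigenvalues X)"

text \<open>The nondivergence form of the operator; used only where the spatial gradient
  does not vanish.\<close>

definition p_operator ::
    "real \<Rightarrow> ((real ^ 'n) \<times> real \<Rightarrow> real) \<Rightarrow> (real ^ 'n) \<times> real \<Rightarrow> real" where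
  "p_operator p \<phi> \<zeta> =
    (let \<nu> = spatial_grad \<phi> \<zeta> /\<^sub>R norm (spatial_grad \<phi> \<zeta>); X = spatial_hessian \<phi> \<zeta>
     in 1 / p * trace X + (p - 2) / p * ((X *v \<nu>) \<bullet> \<nu>))"

text \<open>The value at a critical point of the upper semicontinuous envelope of the operator;
  the sign of \<open>p - 2\<close> decides which extreme eigenvalue occurs.\<close>

definition p_operator_upper ::
    "real \<Rightarrow> ((real ^ 'n) \<times> real \<Rightarrow> real) \<Rightarrow> (real ^ 'n) \<times> real \<Rightarrow> real" where
  "p_operator_upper p \<phi> \<zeta> =
    (let X = spatial_hessian \<phi> \<zeta>
     in 1 / p * trace X
        + (p - 2) / p * (if p \<ge> 2 then max_eigenvalue X else min_eigenvalue X))"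


section \<open>Viscosity subsolutions\<close>

definition usc_on :: "'a::topological_space set \<Rightarrow> ('a \<Rightarrow> real) \<Rightarrow> bool" where
  "usc_on S u \<longleftrightarrow> (\<forall>z\<in>S. \<forall>a>u z. \<forall>\<^sub>F w in at z within S. u w < a)"

definition Linfty_on :: "'a::euclidean_space set \<Rightarrow> ('a \<Rightarrow> real) \<Rightarrow> bool" where
  "Linfty_on S u \<longleftrightarrow>
    u \<in> borel_measurable (lebesgue_on S) \<and> (\<exists>M. AE z in lebesgue_on S. \<bar>u z\<bar> \<le> M)"

definition viscosity_subsolution ::
    "real \<Rightarrow> ((real ^ 'n) \<times> real) set \<Rightarrow> ((real ^ 'n) \<times> real \<Rightarrow> real) \<Rightarrow> bool" where
  "viscosity_subsolution p \<Omega> u \<longleftrightarrow>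
    usc_on \<Omega> u \<and> Linfty_on \<Omega> u \<and>
    (\<forall>\<phi> \<zeta>\<^sub>0. C2_on \<Omega> \<phi> \<and> \<zeta>\<^sub>0 \<in> \<Omega> \<and> (\<forall>\<zeta>\<in>\<Omega>. u \<zeta> - \<phi> \<zeta> \<le> u \<zeta>\<^sub>0 - \<phi> \<zeta>\<^sub>0) \<longrightarrow>
      (if spatial_grad \<phi> \<zeta>\<^sub>0 \<noteq> 0
       then time_deriv \<phi> \<zeta>\<^sub>0 - p_operator p \<phi> \<zeta>\<^sub>0 \<le> 0
       else time_deriv \<phi> \<zeta>\<^sub>0 - p_operator_upper p \<phi> \<zeta>\<^sub>0 \<le> 0))"


section \<open>Perron solutions and regular boundary points\<close>

definition lower_class ::
    "real \<Rightarrow> ((real ^ 'n) \<times> real) set \<Rightarrow> ((real ^ 'n) \<times> real \<Rightarrow> real)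
      \<Rightarrow> ((real ^ 'n) \<times> real \<Rightarrow> real) set" where
  "lower_class p \<Omega> f =
    {v. viscosity_subsolution p \<Omega> v \<and>
        (\<forall>\<zeta>\<in>frontier \<Omega>. Limsup (at \<zeta> within \<Omega>) (\<lambda>\<eta>. ereal (v \<eta>)) \<le> ereal (f \<zeta>))}"

text \<open>The supremum is formed in the extended reals, so that it is meaningful without a
  prior proof that the class is nonempty and bounded above.\<close>

definition lower_perron ::
    "real \<Rightarrow> ((real ^ 'n) \<times> real) set \<Rightarrow> ((real ^ 'n) \<times> real \<Rightarrow> real)
      \<Rightarrow> (real ^ 'n) \<times> real \<Rightarrow> ereal" where
  "lower_perron p \<Omega> f \<zeta> = (SUP v\<in>lower_class p \<Omega> f. ereal (v \<zeta>))"

text \<open>Only meant for points of \<open>frontier \<Omega>\<close>; membership is not part of the definition, so a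
  claim of irregularity has to state it separately.\<close>

definition regular_point ::
    "real \<Rightarrow> ((real ^ 'n) \<times> real) set \<Rightarrow> (real ^ 'n) \<times> real \<Rightarrow> bool" where
  "regular_point p \<Omega> \<zeta>\<^sub>0 \<longleftrightarrow>
    (\<forall>f. continuous_on (frontier \<Omega>) f \<and> bounded (f ` frontier \<Omega>) \<longrightarrow>
      (lower_perron p \<Omega> f \<longlongrightarrow> ereal (f \<zeta>\<^sub>0)) (at \<zeta>\<^sub>0 within \<Omega>))"

end

theory Submission
  imports Defs
begin

text \<open>The proof bounds the lower Perron solution from below by an explicit barrier that has the wrong
  limit at the origin.  Write \<open>L = - ln (- t)\<close>.  The barrier is
  \<open>w (x, t) = 1 + G * L powr - q - L powr - (1 + q) * exp (k * \<bar>x\<bar>\<^sup>2 / - t)\<close> with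
  \<open>k = 1 / (\<beta> * (1 + q))\<close>.  If the factor \<open>1 + q\<close> were absent from \<open>k\<close>, the terms of order
  \<open>\<bar>x\<bar>\<^sup>2 / t\<^sup>2\<close> in the equation would cancel; the slightly wider Gaussian makes them favourable and
  \<open>w\<close> becomes a subsolution for \<open>\<bar>x\<bar>\<^sup>2 / - t\<close> large.  For \<open>\<bar>x\<bar>\<^sup>2 / - t\<close> bounded the error is of order
  \<open>L powr - (1 + q) / - t\<close>, which is integrable up to \<open>t = 0\<close>, and the bounded correction
  \<open>G * L powr - q\<close> absorbs it (\<open>petrovsky_barrier_differential_inequality\<close>).

  On the lateral boundary \<open>\<bar>x\<bar>\<^sup>2 = \<beta> * (1 + \<epsilon>) * (- t) * ln L\<close> the exponential is
  \<open>L powr ((1 + \<epsilon>) / (1 + q))\<close>.  For \<open>(1 + q)\<^sup>2 < 1 + \<epsilon>\<close> it beats the factor \<open>L powr - (1 + q)\<close>, so \<open>w\<close>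
  tends to \<open>- \<infinity>\<close> along the lateral boundary and \<open>w (x, t) \<le> K * - t\<close> on the frontier away from the
  origin (\<open>petrovsky_barrier_boundary_bound\<close>), whereas \<open>w (0, t)\<close> tends to \<open>1\<close>.  Take the boundary
  function \<open>f (x, t) = K * - t\<close>, which vanishes at the origin.  For each \<open>T < 0\<close>, the function equal to
  \<open>w\<close> up to time \<open>T\<close> and to a low constant afterwards is a viscosity subsolution whose upper limits at
  the frontier are at most \<open>f\<close> (\<open>cut_barrier_subsolution\<close>): lowering a
  subsolution after some time is harmless, because only the past restricts a test function from the
  relevant side.  Letting \<open>T\<close> vary, the lower Perron solution
  is at least \<open>w\<close> in the whole domain, and on the axis it does not tend to \<open>f (0, 0) = 0\<close>.

  The operator is singular where the gradient vanishes.  This causes no trouble: the barrier is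
  radial, and at \<open>x = 0\<close> its Hessian is a multiple of the identity, so that all directions give the
  same value (\<open>touching_gaussian_operator\<close>).  A test function touching the barrier from above has a larger
  Hessian, and the operator is monotone; this is \<open>operator_form_ge\<close>, which rests on
  \<open>trace_minus_quadratic_ge\<close>.  The symmetry of the Hessian is needed only to know that its extreme
  eigenvalues exist.\<close>

section \<open>Symmetry of second derivatives\<close>

text \<open>Two applications of the mean value theorem: first to the difference of \<open>\<phi>\<close> across
  the edge in direction \<open>v\<close>, as a function of the position along \<open>u\<close>, then to the first
  derivative along \<open>v\<close>.\<close>

lemma second_difference_mean_value:
  fixes \<phi> :: "'a::real_normed_vector \<Rightarrow> real"
    and \<phi>' :: "'a \<Rightarrow> 'a \<Rightarrow>\<^sub>L real" and \<phi>'' :: "'a \<Rightarrow> 'a \<Rightarrow>\<^sub>L 'a \<Rightarrow>\<^sub>L real"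
  assumes "0 < s"
    and S: "\<And>a b. 0 \<le> a \<Longrightarrow> a \<le> s \<Longrightarrow> 0 \<le> b \<Longrightarrow> b \<le> s \<Longrightarrow> z + a *\<^sub>R u + b *\<^sub>R v \<in> S"
    and d1: "\<And>y. y \<in> S \<Longrightarrow> (\<phi> has_derivative blinfun_apply (\<phi>' y)) (at y)"
    and d2: "\<And>y. y \<in> S \<Longrightarrow> (\<phi>' has_derivative blinfun_apply (\<phi>'' y)) (at y)"
  obtains a b where "0 \<le> a" "a \<le> s" "0 \<le> b" "b \<le> s"
    "\<phi> (z + s *\<^sub>R u + s *\<^sub>R v) - \<phi> (z + s *\<^sub>R u) - \<phi> (z + s *\<^sub>R v) + \<phi> z
      = s\<^sup>2 * \<phi>'' (z + a *\<^sub>R u + b *\<^sub>R v) v u"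
proof -
  define F where "F = (\<lambda>a. \<phi> (z + a *\<^sub>R u + s *\<^sub>R v) - \<phi> (z + a *\<^sub>R u))"
  have F': "DERIV F a :> \<phi>' (z + a *\<^sub>R u + s *\<^sub>R v) u - \<phi>' (z + a *\<^sub>R u) u"
    if "0 \<le> a" "a \<le> s" for a
  proof -
    have "((\<lambda>a. \<phi> (z + a *\<^sub>R u + s *\<^sub>R v)) has_derivative
        (\<lambda>h. \<phi>' (z + a *\<^sub>R u + s *\<^sub>R v) (h *\<^sub>R u))) (at a)"
      by (rule has_derivative_compose[OF _ d1]) (use S[of a s] that \<open>0 < s\<close> in \<open>auto intro!: derivative_eq_intros\<close>)
    moreover have "((\<lambda>a. \<phi> (z + a *\<^sub>R u)) has_derivative
        (\<lambda>h. \<phi>' (z + a *\<^sub>R u) (h *\<^sub>R u))) (at a)"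
      by (rule has_derivative_compose[OF _ d1]) (use S[of a 0] that \<open>0 < s\<close> in \<open>auto intro!: derivative_eq_intros\<close>)
    ultimately show ?thesis
      unfolding F_def has_field_derivative_def
      by (rule has_derivative_eq_rhs[OF has_derivative_diff])
        (auto simp: blinfun.scaleR_right algebra_simps)
  qed
  obtain a where a: "0 < a" "a < s"
      "F s - F 0 = (s - 0) * (\<phi>' (z + a *\<^sub>R u + s *\<^sub>R v) u - \<phi>' (z + a *\<^sub>R u) u)"
    using MVT2[OF \<open>0 < s\<close>, of F "\<lambda>a. \<phi>' (z + a *\<^sub>R u + s *\<^sub>R v) u - \<phi>' (z + a *\<^sub>R u) u"] F'
    by auto
  have G': "DERIV (\<lambda>b. \<phi>' (z + a *\<^sub>R u + b *\<^sub>R v) u) b :> \<phi>'' (z + a *\<^sub>R u + b *\<^sub>R v) v u"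
    if "0 \<le> b" "b \<le> s" for b
  proof -
    have "((\<lambda>b. \<phi>' (z + a *\<^sub>R u + b *\<^sub>R v)) has_derivative
        (\<lambda>h. \<phi>'' (z + a *\<^sub>R u + b *\<^sub>R v) (h *\<^sub>R v))) (at b)"
      by (rule has_derivative_compose[OF _ d2]) (use S[of a b] that a in \<open>auto intro!: derivative_eq_intros\<close>)
    then have "((\<lambda>b. blinfun_apply (\<phi>' (z + a *\<^sub>R u + b *\<^sub>R v)) u) has_derivative
        (\<lambda>h. \<phi>'' (z + a *\<^sub>R u + b *\<^sub>R v) (h *\<^sub>R v) u)) (at b)"
      by (auto intro!: derivative_eq_intros)
    then show ?thesis
      unfolding has_field_derivative_def
      by (rule has_derivative_eq_rhs) (auto simp: blinfun.scaleR_right blinfun.scaleR_left)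
  qed
  obtain b where b: "0 < b" "b < s"
      "\<phi>' (z + a *\<^sub>R u + s *\<^sub>R v) u - \<phi>' (z + a *\<^sub>R u + 0 *\<^sub>R v) u
        = (s - 0) * \<phi>'' (z + a *\<^sub>R u + b *\<^sub>R v) v u"
    using MVT2[OF \<open>0 < s\<close>, of "\<lambda>b. \<phi>' (z + a *\<^sub>R u + b *\<^sub>R v) u"
        "\<lambda>b. \<phi>'' (z + a *\<^sub>R u + b *\<^sub>R v) v u"] G' by auto
  have "\<phi> (z + s *\<^sub>R u + s *\<^sub>R v) - \<phi> (z + s *\<^sub>R u) - \<phi> (z + s *\<^sub>R v) + \<phi> z = F s - F 0"
    by (simp add: F_def)
  also have "\<dots> = s * (s * \<phi>'' (z + a *\<^sub>R u + b *\<^sub>R v) v u)"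
    using a b by simp
  finally show thesis
    using that[of a b] a b by (simp add: power2_eq_square)
qed

text \<open>The second difference over a parallelogram does not change when the two edges are exchanged,
  so the mean value theorem expresses it by \<open>\<phi>'' _ v u\<close> and by \<open>\<phi>'' _ u v\<close> at two nearby
  points.  Letting the parallelogram shrink, continuity of \<open>\<phi>''\<close> gives the claim.  Symmetry of
  the Hessian is what guarantees that the extreme eigenvalues in the operator are
  eigenvalues at all.\<close>

lemma C2_second_derivative_symmetric:
  fixes \<phi> :: "'a::real_normed_vector \<Rightarrow> real"
    and \<phi>' :: "'a \<Rightarrow> 'a \<Rightarrow>\<^sub>L real" and \<phi>'' :: "'a \<Rightarrow> 'a \<Rightarrow>\<^sub>L 'a \<Rightarrow>\<^sub>L real"
  assumes "open S" "z \<in> S"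
    and d1: "\<And>y. y \<in> S \<Longrightarrow> (\<phi> has_derivative blinfun_apply (\<phi>' y)) (at y)"
    and d2: "\<And>y. y \<in> S \<Longrightarrow> (\<phi>' has_derivative blinfun_apply (\<phi>'' y)) (at y)"
    and cont: "continuous_on S \<phi>''"
  shows "\<phi>'' z u v = \<phi>'' z v u"
proof (rule ccontr)
  assume neq: "\<phi>'' z u v \<noteq> \<phi>'' z v u"
  define d where "d = \<bar>\<phi>'' z u v - \<phi>'' z v u\<bar> / 2"
  have "d > 0" using neq by (simp add: d_def)
  have "isCont \<phi>'' z"
    using assms by (simp add: continuous_on_eq_continuous_at)
  then have c: "isCont (\<lambda>y. \<phi>'' y u v) z" "isCont (\<lambda>y. \<phi>'' y v u) z"
    by (auto intro!: continuous_intros)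
  obtain e1 where e1: "e1 > 0" "\<And>y. dist y z < e1 \<Longrightarrow> dist (\<phi>'' y u v) (\<phi>'' z u v) < d"
    using c(1) \<open>d > 0\<close> unfolding continuous_at_eps_delta by blast
  obtain e2 where e2: "e2 > 0" "\<And>y. dist y z < e2 \<Longrightarrow> dist (\<phi>'' y v u) (\<phi>'' z v u) < d"
    using c(2) \<open>d > 0\<close> unfolding continuous_at_eps_delta by blast
  obtain e3 where e3: "e3 > 0" "ball z e3 \<subseteq> S"
    using assms open_contains_ball by blast
  define e where "e = min e1 (min e2 e3)"
  have "e > 0" using e1 e2 e3 by (simp add: e_def)
  define s where "s = e / (2 * (norm u + norm v + 1))"
  have "s > 0" unfolding s_def using \<open>e > 0\<close>
    by (intro divide_pos_pos mult_pos_pos add_nonneg_pos) auto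
  have small: "dist (z + a *\<^sub>R u + b *\<^sub>R v) z < e" if "0 \<le> a" "a \<le> s" "0 \<le> b" "b \<le> s" for a b
  proof -
    have "dist (z + a *\<^sub>R u + b *\<^sub>R v) z = norm (a *\<^sub>R u + b *\<^sub>R v)"
      by (simp add: dist_norm)
    also have "\<dots> \<le> a * norm u + b * norm v"
      using norm_triangle_ineq[of "a *\<^sub>R u" "b *\<^sub>R v"] that by simp
    also have "\<dots> \<le> s * norm u + s * norm v"
      using that by (intro add_mono mult_right_mono) auto
    also have "\<dots> < s * (2 * (norm u + norm v + 1))"
      using \<open>s > 0\<close> by (simp add: algebra_simps add_strict_increasing add_nonneg_pos)
    also have "\<dots> = e"
      unfolding s_def by (simp add: add_nonneg_eq_0_iff)
    finally show ?thesis .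
  qed
  have inS: "z + a *\<^sub>R u + b *\<^sub>R v \<in> S" "z + a *\<^sub>R v + b *\<^sub>R u \<in> S"
    if "0 \<le> a" "a \<le> s" "0 \<le> b" "b \<le> s" for a b
    using small[OF that] small[of b a] that e3 by (auto simp: e_def dist_commute subset_iff add_ac)
  let ?D = "\<phi> (z + s *\<^sub>R u + s *\<^sub>R v) - \<phi> (z + s *\<^sub>R u) - \<phi> (z + s *\<^sub>R v) + \<phi> z"
  obtain a b where ab: "0 \<le> a" "a \<le> s" "0 \<le> b" "b \<le> s"
    "?D = s\<^sup>2 * \<phi>'' (z + a *\<^sub>R u + b *\<^sub>R v) v u"
    by (rule second_difference_mean_value[OF \<open>0 < s\<close> inS(1) d1 d2])
  obtain a' b' where ab': "0 \<le> a'" "a' \<le> s" "0 \<le> b'" "b' \<le> s"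
    "\<phi> (z + s *\<^sub>R v + s *\<^sub>R u) - \<phi> (z + s *\<^sub>R v) - \<phi> (z + s *\<^sub>R u) + \<phi> z
      = s\<^sup>2 * \<phi>'' (z + a' *\<^sub>R v + b' *\<^sub>R u) u v"
    by (rule second_difference_mean_value[OF \<open>0 < s\<close> inS(2) d1 d2])
  have "s\<^sup>2 * \<phi>'' (z + a *\<^sub>R u + b *\<^sub>R v) v u = s\<^sup>2 * \<phi>'' (z + a' *\<^sub>R v + b' *\<^sub>R u) u v"
  proof -
    have "z + s *\<^sub>R v + s *\<^sub>R u = z + s *\<^sub>R u + s *\<^sub>R v" by simp
    then show ?thesis using ab(5) ab'(5) by (simp only:)
  qed
  then have eq: "\<phi>'' (z + a *\<^sub>R u + b *\<^sub>R v) v u = \<phi>'' (z + a' *\<^sub>R v + b' *\<^sub>R u) u v"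
    using \<open>s > 0\<close> by simp
  have "dist (z + a' *\<^sub>R v + b' *\<^sub>R u) z < e"
    using small[of b' a'] ab' by (simp add: add_ac)
  then show False
    using e1(2)[of "z + a' *\<^sub>R v + b' *\<^sub>R u"] e2(2)[of "z + a *\<^sub>R u + b *\<^sub>R v"] small[of a b] ab eq
    unfolding e_def d_def dist_real_def by (simp add: abs_if split: if_splits)
qed

section \<open>Eigenvalues and traces\<close>

text \<open>A maximiser of the Rayleigh quotient on the unit sphere is an eigenvector: the quadratic form
  \<open>l * (w \<bullet> w) - (X *v w) \<bullet> w\<close> is nonnegative and vanishes at the maximiser \<open>v\<close>, so its first
  variation at \<open>v\<close> is zero in every direction.\<close>

lemma symmetric_matrix_eigenvalues_nonempty:
  fixes X :: "real ^ 'n ^ 'n"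
  assumes sym: "\<And>v w. (X *v v) \<bullet> w = (X *v w) \<bullet> v"
  shows "eigenvalues X \<noteq> {}"
proof -
  have "continuous_on (sphere 0 1) (\<lambda>v. (X *v v) \<bullet> v)"
    by (intro continuous_intros linear_continuous_on matrix_vector_mul_bounded_linear)
  moreover have "sphere (0 :: real ^ 'n) 1 \<noteq> {}" by simp
  ultimately obtain v where v: "norm v = 1"
      and max: "\<And>w. norm w = 1 \<Longrightarrow> (X *v w) \<bullet> w \<le> (X *v v) \<bullet> v"
    using continuous_attains_sup[OF compact_sphere[of 0 1], of "\<lambda>v. (X *v v) \<bullet> v"] by auto
  define l where "l = (X *v v) \<bullet> v"
  have le: "(X *v w) \<bullet> w \<le> l * (w \<bullet> w)" for w
  proof (cases "w = 0")
    case False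
    have "(X *v (w /\<^sub>R norm w)) \<bullet> (w /\<^sub>R norm w) \<le> l"
      unfolding l_def using False by (intro max) simp
    then have "(X *v w) \<bullet> w / (norm w)\<^sup>2 \<le> l"
      by (simp add: matrix_vector_mult_scaleR power2_eq_square field_simps)
    then show ?thesis
      using False by (simp add: field_simps power2_norm_eq_inner)
  qed simp
  have "(l *\<^sub>R v - X *v v) \<bullet> w = 0" for w
  proof (rule ccontr)
    assume k: "(l *\<^sub>R v - X *v v) \<bullet> w \<noteq> 0"
    define k where "k = (l *\<^sub>R v - X *v v) \<bullet> w"
    define m where "m = l * (w \<bullet> w) - (X *v w) \<bullet> w"
    have "m \<ge> 0" using le[of w] by (simp add: m_def)
    have nonneg: "0 \<le> 2 * t * k + t\<^sup>2 * m" for t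
    proof -
      have "v \<bullet> v = 1" using v by (simp add: norm_eq_1)
      have "0 \<le> l * ((v + t *\<^sub>R w) \<bullet> (v + t *\<^sub>R w)) - (X *v (v + t *\<^sub>R w)) \<bullet> (v + t *\<^sub>R w)"
        using le by simp
      also have "\<dots> = 2 * t * k + t\<^sup>2 * m"
        using sym[of v w] \<open>v \<bullet> v = 1\<close> unfolding k_def m_def
        by (simp add: matrix_vector_right_distrib matrix_vector_mult_scaleR inner_add_left
            inner_add_right inner_diff_left l_def power2_eq_square algebra_simps inner_commute)
      finally show ?thesis .
    qed
    \<comment> \<open>The step \<open>- r\<close> makes the linear term beat the quadratic one; adding 1 to \<open>m\<close> avoids a
      case distinction for \<open>m = 0\<close>.\<close>
    define r where "r = k / (m + 1)"
    have "k = r * (m + 1)" using \<open>m \<ge> 0\<close> by (simp add: r_def)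
    have "0 \<le> 2 * (- r) * k + (- r)\<^sup>2 * m" by (rule nonneg)
    also have "\<dots> = - (r\<^sup>2 * (m + 2))"
      unfolding \<open>k = r * (m + 1)\<close> by (simp add: algebra_simps power2_eq_square)
    also have "\<dots> < 0"
      using \<open>m \<ge> 0\<close> k unfolding k_def[symmetric] r_def by simp
    finally show False by simp
  qed
  then have "X *v v = l *\<^sub>R v"
    using inner_eq_zero_iff[of "l *\<^sub>R v - X *v v"] by simp
  moreover have "v \<noteq> 0" using v by auto
  ultimately show ?thesis unfolding eigenvalues_def by auto
qed

text \<open>Eigenvectors for different eigenvalues are orthogonal.\<close>

lemma symmetric_matrix_eigenvalues_finite:
  fixes X :: "real ^ 'n ^ 'n"
  assumes sym: "\<And>v w. (X *v v) \<bullet> w = (X *v w) \<bullet> v"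
  shows "finite (eigenvalues X)"
proof -
  have "\<forall>l\<in>eigenvalues X. \<exists>v. v \<noteq> 0 \<and> X *v v = l *\<^sub>R v" unfolding eigenvalues_def by auto
  then obtain e where e: "\<And>l. l \<in> eigenvalues X \<Longrightarrow> e l \<noteq> 0 \<and> X *v e l = l *\<^sub>R e l"
    by metis
  have orth: "e l \<bullet> e m = 0" if "l \<in> eigenvalues X" "m \<in> eigenvalues X" "l \<noteq> m" for l m
    using sym[of "e l" "e m"] e[OF that(1)] e[OF that(2)] that(3)
    by (simp add: inner_commute)
  have "inj_on e (eigenvalues X)"
    using orth e by (metis inj_onI inner_eq_zero_iff)
  moreover have "finite (e ` eigenvalues X)"
    by (rule pairwise_orthogonal_imp_finite)
      (use orth in \<open>auto simp: pairwise_def orthogonal_def\<close>)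
  ultimately show ?thesis by (rule finite_imageD[rotated])
qed

text \<open>With \<open>P\<close> the orthogonal projection along the unit vector \<open>\<xi>\<close>, the left-hand side is the sum of the
  values of the quadratic form at the vectors \<open>P e\<^sub>i\<close>.  These are orthogonal to \<open>\<xi>\<close>, hence to \<open>y\<close>, so
  only the \<open>\<mu>\<close>-part of the lower bound is seen, and their squared lengths add up to \<open>n - 1\<close>.\<close>

lemma trace_minus_quadratic_ge:
  fixes X :: "real ^ 'n ^ 'n"
  assumes Q: "\<And>v. (X *v v) \<bullet> v \<ge> \<mu> * (v \<bullet> v) + k * (y \<bullet> v)\<^sup>2"
    and \<xi>: "norm \<xi> = 1" and y: "y = (y \<bullet> \<xi>) *\<^sub>R \<xi>"
  shows "trace X - (X *v \<xi>) \<bullet> \<xi> \<ge> (real CARD('n) - 1) * \<mu>"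
proof -
  let ?e = "\<lambda>i. axis i (1::real) :: real ^ 'n"
  let ?P = "\<lambda>i. ?e i - \<xi> $ i *\<^sub>R \<xi>"
  have one: "\<xi> \<bullet> \<xi> = 1" using \<xi> by (simp add: norm_eq_1)
  have xe: "\<xi> \<bullet> ?e i = \<xi> $ i" "?e i \<bullet> \<xi> = \<xi> $ i" for i
    by (simp_all add: inner_axis inner_commute[of "axis i 1"])
  have sq: "(\<Sum>i\<in>UNIV. \<xi> $ i * \<xi> $ i) = 1"
    using one by (simp add: inner_vec_def)
  have exp: "(\<Sum>i\<in>UNIV. \<xi> $ i *\<^sub>R ?e i) = \<xi>"
    using basis_expansion[of \<xi>] by (simp add: scalar_mult_eq_scaleR)
  have PP: "?P i \<bullet> ?P i = 1 - \<xi> $ i * \<xi> $ i" for i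
    by (simp add: inner_diff_left inner_diff_right xe one inner_axis_axis algebra_simps)
  have Py: "y \<bullet> ?P i = 0" for i
    by (subst y) (simp add: inner_diff_right xe one)
  have "(real CARD('n) - 1) * \<mu> = (\<Sum>i\<in>UNIV. \<mu> * (?P i \<bullet> ?P i))"
    by (simp add: PP sum_distrib_left[symmetric] sum_subtractf sq)
  also have "\<dots> \<le> (\<Sum>i\<in>UNIV. (X *v ?P i) \<bullet> ?P i)"
    using Q by (intro sum_mono) (metis Py add.right_neutral mult_zero_right power_zero_numeral)
  also have "\<dots> = (\<Sum>i\<in>UNIV. (X *v ?e i) \<bullet> ?e i) - (X *v (\<Sum>i\<in>UNIV. \<xi> $ i *\<^sub>R ?e i)) \<bullet> \<xi>
      - (X *v \<xi>) \<bullet> (\<Sum>i\<in>UNIV. \<xi> $ i *\<^sub>R ?e i) + (\<Sum>i\<in>UNIV. \<xi> $ i * \<xi> $ i) * ((X *v \<xi>) \<bullet> \<xi>)"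
    by (simp add: matrix_vector_mult_diff_distrib matrix_vector_mult_scaleR inner_diff_left
        inner_diff_right sum_subtractf sum.distrib linear_sum[OF matrix_vector_mul_linear]
        inner_sum_left inner_sum_right sum_distrib_right algebra_simps del: matrix_vector_mul_linear)
      (simp add: sum_distrib_left mult_ac)
  also have "\<dots> = trace X - (X *v \<xi>) \<bullet> \<xi>"
    unfolding exp sq
    by (simp add: trace_def matrix_vector_mult_basis inner_axis column_def)
  finally show ?thesis .
qed

section \<open>Test functions touching a Gaussian from above\<close>

lemma local_min_second_derivative_nonneg:
  fixes F F' :: "real \<Rightarrow> real"
  assumes "0 < e" and F: "\<And>t. \<bar>t\<bar> < e \<Longrightarrow> DERIV F t :> F' t" and F': "DERIV F' 0 :> D"
    and min: "\<And>t. \<bar>t\<bar> < e \<Longrightarrow> F 0 \<le> F t"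
  shows "F' 0 = 0" and "0 \<le> D"
proof -
  show zero: "F' 0 = 0"
    by (rule DERIV_local_min[OF F \<open>0 < e\<close>]) (use assms in auto)
  show "0 \<le> D"
  proof (rule ccontr)
    assume "\<not> 0 \<le> D"
    then obtain d where d: "d > 0" "\<And>h. 0 < h \<Longrightarrow> h < d \<Longrightarrow> F' h < 0"
      using DERIV_neg_dec_right[OF F'] zero by auto
    define h where "h = min d e / 2"
    have h: "0 < h" "h < d" "h < e" using d \<open>0 < e\<close> by (auto simp: h_def)
    obtain s where s: "0 < s" "s < h" "F h - F 0 = (h - 0) * F' s"
      using MVT2[OF \<open>0 < h\<close>, of F F'] F h by auto
    have "(h - 0) * F' s < 0" using d(2)[of s] s h by (simp add: mult_pos_neg)
    then show False using s min[of h] h by simp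
  qed
qed

lemma DERIV_along_line:
  fixes \<phi> :: "'a::real_normed_vector \<Rightarrow> real" and A :: "'a \<Rightarrow>\<^sub>L real"
  assumes "(l has_derivative (\<lambda>h. h *\<^sub>R w)) (at r)" "(\<phi> has_derivative blinfun_apply A) (at (l r))"
  shows "DERIV (\<lambda>r. \<phi> (l r)) r :> A w"
  using has_derivative_compose[OF assms]
  by (simp add: has_field_derivative_def blinfun.scaleR_right mult_commute_abs)

text \<open>The spatial gradient, the Hessian and the time derivative are defined slice by slice through
  description operators.  Expressing them by the joint derivatives makes the chain rule along
  lines and the symmetry of \<open>\<phi>''\<close> applicable.\<close>

lemma C2_on_derivatives:
  fixes \<phi> :: "(real ^ 'n) \<times> real \<Rightarrow> real"
  assumes "open S" "C2_on S \<phi>"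
  obtains \<phi>' :: "(real ^ 'n) \<times> real \<Rightarrow> ((real ^ 'n) \<times> real) \<Rightarrow>\<^sub>L real"
    and \<phi>'' :: "(real ^ 'n) \<times> real \<Rightarrow> ((real ^ 'n) \<times> real) \<Rightarrow>\<^sub>L ((real ^ 'n) \<times> real) \<Rightarrow>\<^sub>L real"
  where "\<And>z. z \<in> S \<Longrightarrow> (\<phi> has_derivative blinfun_apply (\<phi>' z)) (at z)"
    and "\<And>z. z \<in> S \<Longrightarrow> (\<phi>' has_derivative blinfun_apply (\<phi>'' z)) (at z)"
    and "\<And>z u v. z \<in> S \<Longrightarrow> \<phi>'' z u v = \<phi>'' z v u"
    and "\<And>z v. z \<in> S \<Longrightarrow> spatial_grad \<phi> z \<bullet> v = \<phi>' z (v, 0)"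
    and "\<And>z v w. z \<in> S \<Longrightarrow> (spatial_hessian \<phi> z *v v) \<bullet> w = \<phi>'' z (v, 0) (w, 0)"
    and "\<And>z. z \<in> S \<Longrightarrow> time_deriv \<phi> z = \<phi>' z (0, 1)"
proof -
  obtain \<phi>' :: "(real ^ 'n) \<times> real \<Rightarrow> ((real ^ 'n) \<times> real) \<Rightarrow>\<^sub>L real"
    and \<phi>'' :: "(real ^ 'n) \<times> real \<Rightarrow> ((real ^ 'n) \<times> real) \<Rightarrow>\<^sub>L ((real ^ 'n) \<times> real) \<Rightarrow>\<^sub>L real"
    where d1: "\<And>z. z \<in> S \<Longrightarrow> (\<phi> has_derivative blinfun_apply (\<phi>' z)) (at z)"
      and d2: "\<And>z. z \<in> S \<Longrightarrow> (\<phi>' has_derivative blinfun_apply (\<phi>'' z)) (at z)"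
      and cont: "continuous_on S \<phi>''"
    using assms(2) unfolding C2_on_def by metis
  have sym: "\<phi>'' z u v = \<phi>'' z v u" if "z \<in> S" for z u v
    by (rule C2_second_derivative_symmetric[OF \<open>open S\<close> that d1 d2 cont])
  define D where "D = (\<lambda>z. \<Sum>i\<in>UNIV. \<phi>' z (axis i 1, 0) *\<^sub>R axis i (1::real))"
  have expand: "(v, 0) = (\<Sum>i\<in>UNIV. v $ i *\<^sub>R (axis i 1 :: real ^ 'n, 0 :: real))" for v
    using basis_expansion[of v]
    by (intro prod_eqI) (simp_all add: fst_sum snd_sum scalar_mult_eq_scaleR)
  have lin: "g (v, 0) = (\<Sum>i\<in>UNIV. v $ i * g (axis i 1, 0))"
    for g :: "((real ^ 'n) \<times> real) \<Rightarrow>\<^sub>L real" and v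
    by (subst expand) (simp only: blinfun.sum_right blinfun.scaleR_right real_scaleR_def)
  have Dv: "D z \<bullet> v = \<phi>' z (v, 0)" for z v
    unfolding D_def lin[of _ v] by (simp add: inner_sum_left inner_axis' mult.commute)
  have grad: "spatial_grad \<phi> z = D z" if "z \<in> S" for z
  proof -
    have "((\<lambda>y. \<phi> (y, snd z)) has_derivative (\<lambda>h. \<phi>' z (h, 0))) (at (fst z))"
      by (rule has_derivative_compose[where f = "\<lambda>y. (y, snd z)" and g = \<phi>])
        (auto intro!: derivative_eq_intros d1 that)
    then have "GDERIV (\<lambda>y. \<phi> (y, snd z)) (fst z) :> D z"
      unfolding gderiv_def by (simp add: Dv[symmetric] inner_commute)
    moreover have "E = D z" if "GDERIV (\<lambda>y. \<phi> (y, snd z)) (fst z) :> E" for E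
      using has_derivative_unique[OF calculation[unfolded gderiv_def] that[unfolded gderiv_def]]
      by (metis inner_commute vector_eq_rdot)
    ultimately show ?thesis unfolding spatial_grad_def by (rule the_equality)
  qed
  have hess: "(spatial_hessian \<phi> z *v v) \<bullet> w = \<phi>'' z (v, 0) (w, 0)" if "z \<in> S" for z v w
  proof -
    define T where "T = {y. (y, snd z) \<in> S}"
    have "open T" unfolding T_def
      using open_vimage[OF \<open>open S\<close>, of "\<lambda>y. (y, snd z)"]
      by (simp add: vimage_def continuous_intros)
    have "fst z \<in> T" using that by (simp add: T_def)
    have c: "((\<lambda>y. \<phi>' (y, snd z)) has_derivative (\<lambda>h. \<phi>'' z (h, 0))) (at (fst z))"
      by (rule has_derivative_compose[where f = "\<lambda>y. (y, snd z)" and g = \<phi>'])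
        (auto intro!: derivative_eq_intros d2 that)
    have "((\<lambda>y. D (y, snd z)) has_derivative
        (\<lambda>h. \<Sum>i\<in>UNIV. \<phi>'' z (h, 0) (axis i 1, 0) *\<^sub>R axis i (1::real))) (at (fst z))"
      unfolding D_def by (auto intro!: derivative_eq_intros c)
    then have "((\<lambda>y. spatial_grad \<phi> (y, snd z)) has_derivative
        (\<lambda>h. \<Sum>i\<in>UNIV. \<phi>'' z (h, 0) (axis i 1, 0) *\<^sub>R axis i (1::real))) (at (fst z))"
      by (rule has_derivative_transform_within_open[OF _ \<open>open T\<close> \<open>fst z \<in> T\<close>])
        (simp add: grad T_def)
    then have "(\<lambda>h. spatial_hessian \<phi> z *v h)
        = (\<lambda>h. \<Sum>i\<in>UNIV. \<phi>'' z (h, 0) (axis i 1, 0) *\<^sub>R axis i (1::real))"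
      unfolding spatial_hessian_def
      by (metis (no_types, lifting) differentiableI has_derivative_unique jacobian_works)
    then have "spatial_hessian \<phi> z *v v
        = (\<Sum>i\<in>UNIV. \<phi>'' z (v, 0) (axis i 1, 0) *\<^sub>R axis i (1::real))"
      by metis
    then show ?thesis
      unfolding lin[of _ w] by (simp add: inner_sum_left inner_axis' mult.commute)
  qed
  have time: "time_deriv \<phi> z = \<phi>' z (0, 1)" if "z \<in> S" for z
  proof -
    have "DERIV (\<lambda>s. \<phi> (fst z, s)) (snd z) :> \<phi>' z (0, 1)"
      by (rule DERIV_along_line) (auto intro!: derivative_eq_intros d1 that)
    then show ?thesis unfolding time_deriv_def by (rule DERIV_imp_deriv)
  qed
  show thesis
    by (rule that[OF d1 d2 sym _ hess time]) (simp_all add: grad Dv)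
qed

text \<open>In each time slice the barrier below has the form \<open>A - H * exp (\<kappa> * (x \<bullet> x))\<close>, and a constant is
  the case \<open>H = 0\<close>; so this one family of comparison functions is enough.  The first and
  second derivative tests are applied along each line through \<open>x\<close>.\<close>

lemma touching_gaussian_spatial:
  fixes x :: "real ^ 'n"
  assumes "open S" and C2: "C2_on S \<phi>" and xt: "(x, t) \<in> S"
    and min: "\<And>y. (y, t) \<in> S \<Longrightarrow>
      \<phi> (x, t) + H * exp (\<kappa> * (x \<bullet> x)) \<le> \<phi> (y, t) + H * exp (\<kappa> * (y \<bullet> y))"
  shows "spatial_grad \<phi> (x, t) = - (2 * \<kappa> * (H * exp (\<kappa> * (x \<bullet> x)))) *\<^sub>R x"
    and "- (2 * \<kappa> * (H * exp (\<kappa> * (x \<bullet> x)))) * (v \<bullet> v)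
      + - (4 * \<kappa>\<^sup>2 * (H * exp (\<kappa> * (x \<bullet> x)))) * (x \<bullet> v)\<^sup>2
      \<le> (spatial_hessian \<phi> (x, t) *v v) \<bullet> v"
proof -
  obtain \<phi>' \<phi>'' where d1: "\<And>z. z \<in> S \<Longrightarrow> (\<phi> has_derivative blinfun_apply (\<phi>' z)) (at z)"
    and d2: "\<And>z. z \<in> S \<Longrightarrow> (\<phi>' has_derivative blinfun_apply (\<phi>'' z)) (at z)"
    and grad: "\<And>z v. z \<in> S \<Longrightarrow> spatial_grad \<phi> z \<bullet> v = \<phi>' z (v, 0)"
    and hess: "\<And>z v w. z \<in> S \<Longrightarrow> (spatial_hessian \<phi> z *v v) \<bullet> w = \<phi>'' z (v, 0) (w, 0)"
    by (rule C2_on_derivatives[OF \<open>open S\<close> C2]) blast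
  let ?E = "H * exp (\<kappa> * (x \<bullet> x))"
  have *: "\<phi>' (x, t) (v, 0) + 2 * \<kappa> * ?E * (x \<bullet> v) = 0 \<and>
      0 \<le> \<phi>'' (x, t) (v, 0) (v, 0) + ?E * (4 * \<kappa>\<^sup>2 * (x \<bullet> v)\<^sup>2 + 2 * \<kappa> * (v \<bullet> v))" for v
  proof -
    let ?l = "\<lambda>r. x + r *\<^sub>R v"
    define F where "F = (\<lambda>r. \<phi> (?l r, t) + H * exp (\<kappa> * (?l r \<bullet> ?l r)))"
    define F' where "F' = (\<lambda>r. \<phi>' (?l r, t) (v, 0)
      + H * exp (\<kappa> * (?l r \<bullet> ?l r)) * (2 * \<kappa> * (?l r \<bullet> v)))"
    have "open {r. (?l r, t) \<in> S}"
      using open_vimage[OF \<open>open S\<close>, of "\<lambda>r. (?l r, t)"]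
      by (simp add: vimage_def continuous_intros)
    then obtain e where "e > 0" "ball 0 e \<subseteq> {r. (?l r, t) \<in> S}"
      by (rule openE[of _ 0]) (use xt in simp_all)
    then have e: "e > 0" "\<And>r. \<bar>r\<bar> < e \<Longrightarrow> (?l r, t) \<in> S"
      by (auto simp: subset_iff dist_real_def)
    have gauss: "DERIV (\<lambda>r. H * exp (\<kappa> * (?l r \<bullet> ?l r))) r
        :> H * exp (\<kappa> * (?l r \<bullet> ?l r)) * (2 * \<kappa> * (?l r \<bullet> v))" for r
      unfolding inner_add_left inner_add_right inner_scaleR_left inner_scaleR_right
      by (auto intro!: derivative_eq_intros simp: algebra_simps inner_commute)
    have l': "((\<lambda>r. (?l r, t)) has_derivative (\<lambda>h. h *\<^sub>R (v, 0))) (at r)" for r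
      by (auto intro!: derivative_eq_intros)
    have F1: "DERIV F r :> F' r" if "\<bar>r\<bar> < e" for r
    proof -
      have "DERIV (\<lambda>r. \<phi> (?l r, t)) r :> \<phi>' (?l r, t) (v, 0)"
        by (rule DERIV_along_line[OF l' d1[OF e(2)[OF that]]])
      then show ?thesis unfolding F_def F'_def by (rule DERIV_add[OF _ gauss])
    qed
    have F2: "DERIV F' 0 :> \<phi>'' (x, t) (v, 0) (v, 0)
        + ?E * (4 * \<kappa>\<^sup>2 * (x \<bullet> v)\<^sup>2 + 2 * \<kappa> * (v \<bullet> v))"
    proof -
      have "((\<lambda>r. \<phi>' (?l r, t)) has_derivative (\<lambda>h. \<phi>'' (?l 0, t) (h *\<^sub>R (v, 0)))) (at 0)"
        using has_derivative_compose[OF l' d2[OF e(2)[of 0]]] e(1) by simp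
      then have "((\<lambda>r. \<phi>' (?l r, t) (v, 0)) has_derivative
          (\<lambda>h. \<phi>'' (x, t) (h *\<^sub>R (v, 0)) (v, 0))) (at 0)"
        by (auto intro!: derivative_eq_intros)
      then have "DERIV (\<lambda>r. \<phi>' (?l r, t) (v, 0)) 0 :> \<phi>'' (x, t) (v, 0) (v, 0)"
        unfolding has_field_derivative_def blinfun.scaleR_right blinfun.scaleR_left
        by (simp add: mult_commute_abs)
      moreover have "DERIV (\<lambda>r. 2 * \<kappa> * (?l r \<bullet> v)) 0 :> 2 * \<kappa> * (v \<bullet> v)"
        unfolding inner_add_left inner_scaleR_left by (auto intro!: derivative_eq_intros)
      ultimately show ?thesis unfolding F'_def
        using DERIV_add[OF _ DERIV_mult[OF gauss[of 0]]]
        by (rule_tac DERIV_cong, blast) (simp add: algebra_simps power2_eq_square)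
    qed
    have F3: "F 0 \<le> F r" if "\<bar>r\<bar> < e" for r
      unfolding F_def using min[OF e(2)[OF that]] by simp
    show ?thesis
      using local_min_second_derivative_nonneg[OF e(1) F1 F2 F3]
      unfolding F'_def by (simp add: algebra_simps)
  qed
  have "(spatial_grad \<phi> (x, t) + (2 * \<kappa> * ?E) *\<^sub>R x) \<bullet> v = 0" for v
    using *[of v] grad[OF xt] by (simp add: inner_add_left)
  then have "spatial_grad \<phi> (x, t) + (2 * \<kappa> * ?E) *\<^sub>R x = 0"
    by (metis inner_eq_zero_iff)
  then show "spatial_grad \<phi> (x, t) = - (2 * \<kappa> * ?E) *\<^sub>R x"
    by (simp add: eq_neg_iff_add_eq_0)
  show "- (2 * \<kappa> * ?E) * (v \<bullet> v) + - (4 * \<kappa>\<^sup>2 * ?E) * (x \<bullet> v)\<^sup>2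
      \<le> (spatial_hessian \<phi> (x, t) *v v) \<bullet> v"
    using *[of v] by (simp add: hess[OF xt] algebra_simps)
qed

text \<open>Splitting \<open>trace X + (p - 2) * (X \<xi> \<bullet> \<xi>)\<close> as \<open>(trace X - X \<xi> \<bullet> \<xi>) + (p - 1) * (X \<xi> \<bullet> \<xi>)\<close>
  writes it as a combination with nonnegative coefficients, which makes the operator
  monotone for every \<open>p > 1\<close> and every unit vector \<open>\<xi>\<close>.  The vector \<open>\<xi>\<close> will be the
  normalised gradient, or an eigenvector when the gradient vanishes.\<close>

lemma operator_form_ge:
  fixes X :: "real ^ 'n ^ 'n"
  assumes "1 < p" and Q: "\<And>v. (X *v v) \<bullet> v \<ge> \<mu> * (v \<bullet> v) + k * (y \<bullet> v)\<^sup>2"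
    and \<xi>: "norm \<xi> = 1" and y: "y = (y \<bullet> \<xi>) *\<^sub>R \<xi>"
  shows "((real CARD('n) + p - 2) * \<mu> + (p - 1) * k * (y \<bullet> y)) / p
    \<le> 1 / p * trace X + (p - 2) / p * ((X *v \<xi>) \<bullet> \<xi>)"
proof -
  have one: "\<xi> \<bullet> \<xi> = 1" using \<xi> by (simp add: norm_eq_1)
  have yy: "y \<bullet> y = (y \<bullet> \<xi>)\<^sup>2"
    by (subst y, subst (2) y) (simp add: one power2_eq_square)
  have "(p - 1) * (\<mu> + k * (y \<bullet> y)) \<le> (p - 1) * ((X *v \<xi>) \<bullet> \<xi>)"
    using Q[of \<xi>] \<open>1 < p\<close> by (intro mult_left_mono) (auto simp: one yy)
  then have "(real CARD('n) + p - 2) * \<mu> + (p - 1) * k * (y \<bullet> y)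
      \<le> trace X + (p - 2) * ((X *v \<xi>) \<bullet> \<xi>)"
    using trace_minus_quadratic_ge[OF Q \<xi> y] by (simp add: algebra_simps)
  then show ?thesis
    using \<open>1 < p\<close> by (simp add: divide_right_mono add_divide_distrib[symmetric])
qed

text \<open>\<open>B\<close> is the value of the operator on \<open>- H * exp (\<kappa> * (x \<bullet> x))\<close>.  A nonzero gradient is parallel to
  \<open>x\<close>, which is an eigenvector of the Hessian of the Gaussian.  A vanishing
  gradient means \<open>\<kappa> * H * x = 0\<close>; then the bound on the Hessian is a multiple of the identity, and
  the eigenvector of whichever extreme eigenvalue occurs can take the place of the normalised
  gradient.\<close>

lemma touching_gaussian_operator:
  fixes x :: "real ^ 'n" and p \<kappa> H t :: real
  defines "E \<equiv> H * exp (\<kappa> * (x \<bullet> x))"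
  defines "B \<equiv> - E * (2 * \<kappa> * (real CARD('n) + p - 2) + 4 * \<kappa>\<^sup>2 * (p - 1) * (x \<bullet> x)) / p"
  assumes "1 < p" and "open S" and C2: "C2_on S \<phi>" and xt: "(x, t) \<in> S"
    and min: "\<And>y. (y, t) \<in> S \<Longrightarrow>
      \<phi> (x, t) + H * exp (\<kappa> * (x \<bullet> x)) \<le> \<phi> (y, t) + H * exp (\<kappa> * (y \<bullet> y))"
  shows "spatial_grad \<phi> (x, t) \<noteq> 0 \<Longrightarrow> B \<le> p_operator p \<phi> (x, t)"
    and "spatial_grad \<phi> (x, t) = 0 \<Longrightarrow> B \<le> p_operator_upper p \<phi> (x, t)"
proof -
  define X where "X = spatial_hessian \<phi> (x, t)"
  define g where "g = spatial_grad \<phi> (x, t)"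
  have g: "g = - (2 * \<kappa> * E) *\<^sub>R x"
    unfolding g_def E_def by (rule touching_gaussian_spatial[OF \<open>open S\<close> C2 xt min])
  have Q: "(X *v v) \<bullet> v \<ge> - (2 * \<kappa> * E) * (v \<bullet> v) + - (4 * \<kappa>\<^sup>2 * E) * (x \<bullet> v)\<^sup>2" for v
    unfolding X_def E_def by (rule touching_gaussian_spatial[OF \<open>open S\<close> C2 xt min])
  have B: "B = ((real CARD('n) + p - 2) * - (2 * \<kappa> * E) + (p - 1) * - (4 * \<kappa>\<^sup>2 * E) * (x \<bullet> x)) / p"
    unfolding B_def by (simp add: algebra_simps)
  show "B \<le> p_operator p \<phi> (x, t)" if "spatial_grad \<phi> (x, t) \<noteq> 0"
  proof -
    define \<xi> where "\<xi> = g /\<^sub>R norm g"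
    have "g \<noteq> 0" using that by (simp add: g_def)
    then have "norm \<xi> = 1" by (simp add: \<xi>_def)
    define a where "a = 2 * \<kappa> * E"
    have ga: "g = - a *\<^sub>R x" using g by (simp add: a_def)
    then have "a \<noteq> 0" using \<open>g \<noteq> 0\<close> by auto
    have "g = norm g *\<^sub>R \<xi>" using \<open>g \<noteq> 0\<close> by (simp add: \<xi>_def)
    moreover have "x = - inverse a *\<^sub>R g" using \<open>a \<noteq> 0\<close> unfolding ga by simp
    ultimately have "x = - inverse a *\<^sub>R (norm g *\<^sub>R \<xi>)" by simp
    then obtain r where r: "x = r *\<^sub>R \<xi>" by (metis scaleR_scaleR)
    have "x = (x \<bullet> \<xi>) *\<^sub>R \<xi>"
      unfolding r using \<open>norm \<xi> = 1\<close> by (simp add: norm_eq_1)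
    from operator_form_ge[OF \<open>1 < p\<close> Q \<open>norm \<xi> = 1\<close> this] show ?thesis
      unfolding B p_operator_def Let_def X_def[symmetric] g_def[symmetric] \<xi>_def by simp
  qed
  show "B \<le> p_operator_upper p \<phi> (x, t)" if "spatial_grad \<phi> (x, t) = 0"
  proof -
    have kx: "4 * \<kappa>\<^sup>2 * E * (x \<bullet> v) = 0" for v
    proof -
      have "(2 * \<kappa> * E) *\<^sub>R x = 0" using that g by (simp add: g_def)
      then have "\<kappa> * E * (x \<bullet> v) = 0" by auto
      then show ?thesis by (auto simp: power2_eq_square)
    qed
    have Q0: "(X *v v) \<bullet> v \<ge> - (2 * \<kappa> * E) * (v \<bullet> v) + 0 * (0 \<bullet> v)\<^sup>2" for v
      using Q[of v] kx[of v] by (auto simp: power2_eq_square)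
    obtain \<phi>'' :: "_ \<Rightarrow> _ \<Rightarrow>\<^sub>L ((real ^ 'n) \<times> real) \<Rightarrow>\<^sub>L real"
      where "\<And>z u v. z \<in> S \<Longrightarrow> \<phi>'' z u v = \<phi>'' z v u"
        "\<And>z v w. z \<in> S \<Longrightarrow> (spatial_hessian \<phi> z *v v) \<bullet> w = \<phi>'' z (v, 0) (w, 0)"
      by (rule C2_on_derivatives[OF \<open>open S\<close> C2]) blast
    then have sym: "(X *v v) \<bullet> w = (X *v w) \<bullet> v" for v w
      unfolding X_def using xt by metis
    define l where "l = (if p \<ge> 2 then max_eigenvalue X else min_eigenvalue X)"
    have "l \<in> eigenvalues X"
      unfolding l_def max_eigenvalue_def min_eigenvalue_def
      using symmetric_matrix_eigenvalues_finite[OF sym] symmetric_matrix_eigenvalues_nonempty[OF sym]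
      by auto
    then obtain v where v: "v \<noteq> 0" "X *v v = l *\<^sub>R v" by (auto simp: eigenvalues_def)
    define \<xi> where "\<xi> = v /\<^sub>R norm v"
    have "norm \<xi> = 1" using v by (simp add: \<xi>_def)
    have "X *v \<xi> = l *\<^sub>R \<xi>" using v by (simp add: \<xi>_def matrix_vector_mult_scaleR)
    then have "(X *v \<xi>) \<bullet> \<xi> = l" using \<open>norm \<xi> = 1\<close> by (simp add: norm_eq_1)
    then show ?thesis
      using operator_form_ge[OF \<open>1 < p\<close> Q0 \<open>norm \<xi> = 1\<close>] kx[of x]
      unfolding B p_operator_upper_def Let_def X_def[symmetric] l_def[symmetric] by auto
  qed
qed

text \<open>Only past times are compared, and so the inequality is one-sided.  This is what allows a
  subsolution to be lowered after a given time, since a touching point at that time sees the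
  original function only from the past.\<close>

lemma touching_time:
  fixes x :: "real ^ 'n"
  assumes "open S" and C2: "C2_on S \<phi>" and xt: "(x, t) \<in> S"
    and b: "DERIV b t :> b'" and "e > 0"
    and max: "\<And>s. t - e < s \<Longrightarrow> s < t \<Longrightarrow> (x, s) \<in> S \<Longrightarrow> b s - \<phi> (x, s) \<le> b t - \<phi> (x, t)"
  shows "time_deriv \<phi> (x, t) \<le> b'"
proof (rule ccontr)
  assume neg: "\<not> time_deriv \<phi> (x, t) \<le> b'"
  obtain \<phi>' where d1: "\<And>z. z \<in> S \<Longrightarrow> (\<phi> has_derivative blinfun_apply (\<phi>' z)) (at z)"
    and time: "\<And>z. z \<in> S \<Longrightarrow> time_deriv \<phi> z = \<phi>' z (0, 1)"
    by (rule C2_on_derivatives[OF \<open>open S\<close> C2]) blast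
  have "DERIV (\<lambda>s. \<phi> (x, s)) t :> time_deriv \<phi> (x, t)"
    unfolding time[OF xt] by (rule DERIV_along_line) (auto intro!: derivative_eq_intros d1 xt)
  then have "DERIV (\<lambda>s. b s - \<phi> (x, s)) t :> b' - time_deriv \<phi> (x, t)"
    by (rule DERIV_diff[OF b])
  then obtain d where d: "d > 0"
      "\<And>h. 0 < h \<Longrightarrow> h < d \<Longrightarrow> b t - \<phi> (x, t) < b (t - h) - \<phi> (x, t - h)"
    using DERIV_neg_dec_left[of "\<lambda>s. b s - \<phi> (x, s)" "b' - time_deriv \<phi> (x, t)" t] neg by auto
  have "open {s. (x, s) \<in> S}"
    using open_vimage[OF \<open>open S\<close>, of "\<lambda>s. (x, s)"] by (simp add: vimage_def continuous_intros)
  then obtain r where "r > 0" "ball t r \<subseteq> {s. (x, s) \<in> S}"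
    by (rule openE[of _ t]) (use xt in simp_all)
  then have r: "r > 0" "\<And>s. \<bar>s - t\<bar> < r \<Longrightarrow> (x, s) \<in> S"
    by (auto simp: subset_iff dist_real_def)
  define h where "h = min e (min d r) / 2"
  have h: "0 < h" "h < e" "h < d" "h < r" using \<open>e > 0\<close> d r by (auto simp: h_def)
  show False
    using max[of "t - h"] d(2)[of h] r(2)[of "t - h"] h by simp
qed

section \<open>The barrier\<close>

text \<open>The exponential is the backward Gaussian weight \<open>exp (\<bar>x\<bar>\<^sup>2 / (\<beta> * - t))\<close> up to a slight widening
  through \<open>k\<close>, and the powers of \<open>- ln (- t)\<close> are tuned so that \<open>G\<close> times the time derivative of
  the first has the same order as the second divided by \<open>- t\<close>.\<close>

definition petrovsky_barrier :: "real \<Rightarrow> real \<Rightarrow> real \<Rightarrow> (real ^ 'n) \<times> real \<Rightarrow> real" where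
  "petrovsky_barrier q k G z =
    1 + G * (- ln (- snd z)) powr - q
      - (- ln (- snd z)) powr - (1 + q) * exp (k / - snd z * (fst z \<bullet> fst z))"

text \<open>The linear factor is negative for \<open>E > C / m\<close>.\<close>

lemma exp_times_decreasing_linear_le:
  fixes C m E :: real
  assumes "0 \<le> C" "0 < m" "0 \<le> E"
  shows "exp E * (C - m * E) \<le> C * exp (C / m)"
proof (cases "C / m \<le> E")
  case True
  then have "C - m * E \<le> 0" using \<open>0 < m\<close> by (simp add: field_simps)
  then have "exp E * (C - m * E) \<le> 0" by (simp add: mult_nonneg_nonpos)
  also have "0 \<le> C * exp (C / m)" using assms by simp
  finally show ?thesis .
next
  case False
  have "exp E * (C - m * E) \<le> exp E * C"
    using assms by (intro mult_left_mono) auto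
  also have "\<dots> \<le> exp (C / m) * C"
    using False assms by (intro mult_right_mono) auto
  finally show ?thesis by (simp add: mult.commute)
qed

lemma petrovsky_barrier_DERIV_time:
  fixes x :: "real ^ 'n" and k q G t :: real
  assumes "- 1 < t" "t < 0"
  defines "s \<equiv> - t" and "L \<equiv> - ln (- t)" and "E \<equiv> k / - t * (x \<bullet> x)"
  shows "DERIV (\<lambda>t. petrovsky_barrier q k G (x, t)) t
    :> L powr - (1 + q) / s * (exp E * ((1 + q) / L - E) - q * G)"
proof -
  have "L > 0" using assms by (simp add: ln_less_zero)
  have "s > 0" using assms by simp
  have L: "DERIV (\<lambda>t. - ln (- t)) t :> 1 / s"
    using assms by (auto intro!: derivative_eq_intros simp: field_simps)
  have powr: "DERIV (\<lambda>t. (- ln (- t)) powr r) t :> r * L powr (r - 1) / s" for r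
    using DERIV_fun_powr[OF L, of r] \<open>L > 0\<close> by (simp add: L_def)
  have ex: "DERIV (\<lambda>t. exp (k / - t * (x \<bullet> x))) t :> exp E * E / s"
    unfolding E_def s_def using assms
    by (auto intro!: derivative_eq_intros simp: field_simps power2_eq_square)
  have p1: "L powr (- q - 1) = L powr - (1 + q)" by (rule arg_cong[of _ _ "\<lambda>r. L powr r"]) simp
  have p2: "L powr (- (1 + q) - 1) = L powr - (1 + q) / L"
    using \<open>L > 0\<close> by (simp only: powr_diff) simp
  have "DERIV (\<lambda>t. 1 + G * (- ln (- t)) powr - q - (- ln (- t)) powr - (1 + q) * exp (k / - t * (x \<bullet> x))) t
      :> 0 + G * (- q * L powr (- q - 1) / s)
        - ((- (1 + q) * L powr (- (1 + q) - 1) / s) * exp E + (exp E * E / s) * L powr - (1 + q))"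
    using DERIV_diff[OF DERIV_add[OF DERIV_const[of 1] DERIV_cmult[OF powr[of "- q"], of G]]
        DERIV_mult[OF powr[of "- (1 + q)"] ex]]
    unfolding E_def[symmetric] L_def[symmetric] .
  then show ?thesis
    unfolding petrovsky_barrier_def fst_conv snd_conv p1 p2
    by (rule DERIV_cong) (use \<open>L > 0\<close> \<open>s > 0\<close> in \<open>simp add: field_simps\<close>)
qed

text \<open>The left-hand side is the time derivative of the barrier, the right-hand side the operator
  applied to it.  Put \<open>E = k * \<bar>x\<bar>\<^sup>2 / - t\<close>.  Differentiating the exponential in time gives a term with
  \<open>- E\<close> and the second radial derivative one with \<open>- E / (1 + q)\<close>; the choice of \<open>k\<close>
  produces exactly this factor.  The surplus \<open>- E * q / (1 + q)\<close> dominates all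
  remaining terms, bounded by the constant \<open>C\<close>, once \<open>E\<close> is large.  For smaller \<open>E\<close> the
  exponential is bounded, and the derivative of \<open>G * L powr - q\<close>, of the same order
  \<open>L powr - (1 + q) / - t\<close> as the error, compensates it.\<close>

lemma petrovsky_barrier_differential_inequality:
  fixes x :: "real ^ 'n" and p c k q C G t :: real
  assumes "1 < p" "0 < c" "c < 1" "- c < t" "t < 0" "0 < q"
    and k: "k = p / (4 * (p - 1) * (1 + q))"
    and C: "C = (1 + q) / - ln c + 2 * k * (real CARD('n) + p - 2) / p"
    and G: "C * exp (C / (q / (1 + q))) \<le> q * G"
  defines "H \<equiv> (- ln (- t)) powr - (1 + q)"
  shows "H / - t * (exp (k / - t * (x \<bullet> x)) * ((1 + q) / - ln (- t) - k / - t * (x \<bullet> x)) - q * G)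
    \<le> - (H * exp (k / - t * (x \<bullet> x)))
        * (2 * (k / - t) * (real CARD('n) + p - 2) + 4 * (k / - t)\<^sup>2 * (p - 1) * (x \<bullet> x)) / p"
proof -
  define s where "s = - t"
  define L where "L = - ln (- t)"
  define E where "E = k / - t * (x \<bullet> x)"
  define N where "N = real CARD('n) + p - 2"
  have "s > 0" "s < c" using assms by (auto simp: s_def)
  then have "- ln c < L" using assms by (simp add: L_def)
  have c0: "0 < - ln c" using assms by (simp add: ln_less_zero)
  have "k > 0" using assms by simp
  have "E \<ge> 0" unfolding E_def using \<open>k > 0\<close> \<open>t < 0\<close>
    by (intro mult_nonneg_nonneg divide_nonneg_nonneg) auto
  have "real CARD('n) \<ge> 1" by (simp add: Suc_leI)
  then have "N \<ge> 0" unfolding N_def using \<open>1 < p\<close> by linarith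
  have "C \<ge> 0" unfolding C N_def[symmetric]
    using c0 \<open>k > 0\<close> \<open>N \<ge> 0\<close> \<open>1 < p\<close> \<open>0 < q\<close>
    by (intro add_nonneg_nonneg divide_nonneg_nonneg) auto
  have "(1 + q) / L \<le> (1 + q) / - ln c"
  proof (rule divide_left_mono)
    show "0 < L * - ln c" using \<open>- ln c < L\<close> c0 by (intro mult_pos_pos) linarith+
  qed (use \<open>- ln c < L\<close> \<open>0 < q\<close> in auto)
  then have "exp E * ((1 + q) / L + 2 * k * N / p - q / (1 + q) * E) \<le> exp E * (C - q / (1 + q) * E)"
    unfolding C N_def by simp
  also have "\<dots> \<le> C * exp (C / (q / (1 + q)))"
    using \<open>0 \<le> C\<close> \<open>0 < q\<close> \<open>0 \<le> E\<close> by (intro exp_times_decreasing_linear_le) auto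
  also have "\<dots> \<le> q * G" by (rule G)
  finally have "exp E * ((1 + q) / L + 2 * k * N / p - q / (1 + q) * E) \<le> q * G" .
  moreover have "q / (1 + q) * E = E - E / (1 + q)" using \<open>0 < q\<close> by (simp add: field_simps)
  ultimately have "exp E * ((1 + q) / L + 2 * k * N / p - (E - E / (1 + q))) \<le> q * G"
    by (simp only:)
  then have main: "exp E * ((1 + q) / L - E) - q * G \<le> - exp E * (2 * k * N / p + E / (1 + q))"
    by (simp only: right_diff_distrib distrib_left mult_minus_left)
  have quad: "4 * (k / s)\<^sup>2 * (p - 1) * (x \<bullet> x) / p = E / (1 + q) / s"
  proof -
    have "4 * k * (p - 1) / p = 1 / (1 + q)"
    proof -
      have "4 * (p / (4 * r * (1 + q))) * r / p = 1 / (1 + q)" if "0 < r" for r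
        using that \<open>1 < p\<close> \<open>0 < q\<close> by simp
      then show ?thesis unfolding k using \<open>1 < p\<close> by simp
    qed
    moreover have "4 * (k / s)\<^sup>2 * (p - 1) * (x \<bullet> x) / p = (4 * k * (p - 1) / p) * E / s"
      unfolding E_def s_def by (simp add: power2_eq_square mult_ac)
    ultimately show ?thesis by simp
  qed
  have "H / s * (exp E * ((1 + q) / L - E) - q * G)
      \<le> H / s * (- exp E * (2 * k * N / p + E / (1 + q)))"
    using main \<open>s > 0\<close> by (intro mult_left_mono) (auto simp: H_def)
  also have "\<dots> = - (H * exp E) * (2 * (k / s) * N / p + E / (1 + q) / s)"
    using \<open>s > 0\<close> by (simp add: field_simps)
  also have "\<dots> = - (H * exp E) * (2 * (k / s) * N + 4 * (k / s)\<^sup>2 * (p - 1) * (x \<bullet> x)) / p"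
    unfolding quad[symmetric] by (simp only: add_divide_distrib distrib_left times_divide_eq_right)
  finally show ?thesis unfolding s_def L_def E_def N_def .
qed

lemma petrovsky_barrier_continuous_on:
  "continuous_on {z :: (real ^ 'n) \<times> real. - 1 < snd z \<and> snd z < 0} (petrovsky_barrier q k G)"
proof -
  have "continuous_on {z :: (real ^ 'n) \<times> real. - 1 < snd z \<and> snd z < 0}
    (\<lambda>z. 1 + G * (- ln (- snd z)) powr - q
      - (- ln (- snd z)) powr - (1 + q) * exp (k / - snd z * (fst z \<bullet> fst z)))"
    by (intro continuous_intros) (auto simp: ln_eq_zero_iff)
  then show ?thesis unfolding petrovsky_barrier_def[abs_def] .
qed

section \<open>Cutting a subsolution off after a given time\<close>

text \<open>The functions of the Perron class must also respect the boundary value at the origin, which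
  the barrier exceeds.  Replacing the barrier by a low constant after time \<open>T < 0\<close> removes this
  conflict without changing it before \<open>T\<close>.\<close>

definition cut_after :: "real \<Rightarrow> real \<Rightarrow> ('a \<times> real \<Rightarrow> real) \<Rightarrow> 'a \<times> real \<Rightarrow> real" where
  "cut_after T m u z = (if snd z \<le> T then u z else m)"

text \<open>This serves both for upper semicontinuity and for the upper limits at boundary points.  It
  needs \<open>m < a\<close> also for \<open>snd z \<le> T\<close>, because at \<open>snd z = T\<close> the values \<open>m\<close> are attained nearby.\<close>

lemma cut_after_eventually_less:
  assumes "snd z \<le> T \<Longrightarrow> isCont u z \<and> u z < a" and "m < a"
  shows "\<forall>\<^sub>F y in at z within S. cut_after T m u y < a"
proof (cases "snd z \<le> T")
  case True
  then have "(u \<longlongrightarrow> u z) (at z within S)" "u z < a"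
    using assms(1) by (auto intro: continuous_at_imp_continuous_at_within simp: continuous_within[symmetric])
  then have "\<forall>\<^sub>F y in at z within S. u y < a" by (rule order_tendstoD)
  then show ?thesis
    by eventually_elim (use \<open>m < a\<close> in \<open>simp add: cut_after_def\<close>)
next
  case False
  have "(snd \<longlongrightarrow> snd z) (at z within S)" by (intro tendsto_intros)
  then have "\<forall>\<^sub>F y in at z within S. T < snd y"
    by (rule order_tendstoD) (use False in simp)
  then show ?thesis
    by eventually_elim (use \<open>m < a\<close> in \<open>simp add: cut_after_def\<close>)
qed

text \<open>At a touching point the cut barrier is, in its time slice, a Gaussian up to time \<open>T\<close> and
  a constant afterwards, and in both cases the same formula is valid at slightly earlier times.\<close>

lemma cut_barrier_subsolution:
  fixes \<Omega> :: "((real ^ 'n) \<times> real) set"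
  assumes "1 < p" "0 < c" "c < 1" "0 < q"
    and k: "k = p / (4 * (p - 1) * (1 + q))"
    and C: "C = (1 + q) / - ln c + 2 * k * (real CARD('n) + p - 2) / p"
    and G: "C * exp (C / (q / (1 + q))) \<le> q * G"
    and "open \<Omega>" and \<Omega>: "\<And>z. z \<in> \<Omega> \<Longrightarrow> - c < snd z \<and> snd z < 0"
    and bd: "\<And>z. z \<in> \<Omega> \<Longrightarrow> snd z \<le> T \<Longrightarrow> \<bar>petrovsky_barrier q k G z\<bar> < M"
    and "0 \<le> M"
  shows "viscosity_subsolution p \<Omega> (cut_after T (- M) (petrovsky_barrier q k G))"
proof -
  let ?w = "petrovsky_barrier q k G :: (real ^ 'n) \<times> real \<Rightarrow> real"
  let ?v = "cut_after T (- M) ?w"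
  have cont: "continuous_on \<Omega> ?w"
    by (rule continuous_on_subset[OF petrovsky_barrier_continuous_on]) (use \<Omega> \<open>c < 1\<close> in force)
  have "usc_on \<Omega> ?v"
    unfolding usc_on_def
  proof (intro ballI allI impI)
    fix z a assume "z \<in> \<Omega>" and a: "?v z < a"
    show "\<forall>\<^sub>F y in at z within \<Omega>. ?v y < a"
    proof (rule cut_after_eventually_less)
      show "isCont ?w z \<and> ?w z < a" if "snd z \<le> T"
        using cont \<open>open \<Omega>\<close> \<open>z \<in> \<Omega>\<close> a that
        by (simp add: continuous_on_eq_continuous_at cut_after_def)
      show "- M < a"
        using a bd[OF \<open>z \<in> \<Omega>\<close>] by (auto simp: cut_after_def split: if_splits)
    qed
  qed
  moreover have "Linfty_on \<Omega> ?v"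
  proof -
    have \<Omega>m: "\<Omega> \<in> sets lebesgue" using \<open>open \<Omega>\<close> by (intro sets_completionI_sets) simp
    have "?w \<in> borel_measurable (lebesgue_on \<Omega>)"
      by (rule continuous_imp_measurable_on_sets_lebesgue[OF cont \<Omega>m])
    moreover have "snd \<in> borel_measurable (lebesgue_on \<Omega>)"
      by (rule continuous_imp_measurable_on_sets_lebesgue[OF _ \<Omega>m]) (intro continuous_intros)
    ultimately have "(\<lambda>z. if snd z \<le> T then ?w z else - M) \<in> borel_measurable (lebesgue_on \<Omega>)"
      by measurable
    moreover have "AE z in lebesgue_on \<Omega>. \<bar>?v z\<bar> \<le> M"
      using bd \<open>0 \<le> M\<close> \<Omega>m
      by (intro AE_I2) (auto simp: cut_after_def intro: less_imp_le)
    ultimately show ?thesis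
      unfolding Linfty_on_def cut_after_def[abs_def] by blast
  qed
  moreover have "if spatial_grad \<phi> z \<noteq> 0 then time_deriv \<phi> z - p_operator p \<phi> z \<le> 0
      else time_deriv \<phi> z - p_operator_upper p \<phi> z \<le> 0"
    if C2: "C2_on \<Omega> \<phi>" and z: "z \<in> \<Omega>" and max: "\<forall>y\<in>\<Omega>. ?v y - \<phi> y \<le> ?v z - \<phi> z" for \<phi> z
  proof -
    obtain x t where zt: "z = (x, t)" by (cases z)
    note xt = z[unfolded zt]
    have t: "- c < t" "t < 0" using \<Omega>[OF xt] by auto
    define \<kappa> where "\<kappa> = k / - t"
    \<comment> \<open>\<open>H = 0\<close> encodes the constant slices after time \<open>T\<close>.\<close>
    define H where "H = (if t \<le> T then (- ln (- t)) powr - (1 + q) else 0)"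
    have slice: "\<phi> (x, t) + H * exp (\<kappa> * (x \<bullet> x)) \<le> \<phi> (y, t) + H * exp (\<kappa> * (y \<bullet> y))"
      if "(y, t) \<in> \<Omega>" for y
      using max[unfolded zt, rule_format, OF that]
      by (simp add: cut_after_def petrovsky_barrier_def H_def \<kappa>_def split: if_splits)
    let ?B = "- (H * exp (\<kappa> * (x \<bullet> x)))
      * (2 * \<kappa> * (real CARD('n) + p - 2) + 4 * \<kappa>\<^sup>2 * (p - 1) * (x \<bullet> x)) / p"
    have "time_deriv \<phi> (x, t) \<le> ?B"
    proof (cases "t \<le> T")
      case True
      have "time_deriv \<phi> (x, t) \<le> (- ln (- t)) powr - (1 + q) / - t
          * (exp (k / - t * (x \<bullet> x)) * ((1 + q) / - ln (- t) - k / - t * (x \<bullet> x)) - q * G)"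
      proof (rule touching_time[OF \<open>open \<Omega>\<close> C2 xt petrovsky_barrier_DERIV_time zero_less_one])
        show "?w (x, s) - \<phi> (x, s) \<le> ?w (x, t) - \<phi> (x, t)" if "s < t" "(x, s) \<in> \<Omega>" for s
          using max[unfolded zt, rule_format, OF that(2)] that True by (simp add: cut_after_def)
      qed (use t \<open>c < 1\<close> in auto)
      also have "\<dots> \<le> ?B"
        using petrovsky_barrier_differential_inequality[OF \<open>1 < p\<close> \<open>0 < c\<close> \<open>c < 1\<close> t \<open>0 < q\<close> k C G] True
        by (simp add: H_def \<kappa>_def)
      finally show ?thesis .
    next
      case False
      have "time_deriv \<phi> (x, t) \<le> 0"
      proof (rule touching_time[OF \<open>open \<Omega>\<close> C2 xt DERIV_const])
        show "0 < t - T" using False by simp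
        show "- M - \<phi> (x, s) \<le> - M - \<phi> (x, t)" if "t - (t - T) < s" "(x, s) \<in> \<Omega>" for s
          using max[unfolded zt, rule_format, OF that(2)] that False by (simp add: cut_after_def)
      qed
      then show ?thesis using False by (simp add: H_def)
    qed
    then show ?thesis
      using touching_gaussian_operator[OF \<open>1 < p\<close> \<open>open \<Omega>\<close> C2 xt slice] by (auto simp: zt)
  qed
  ultimately show ?thesis unfolding viscosity_subsolution_def by blast
qed

text \<open>On the lateral boundary \<open>\<bar>x\<bar>\<^sup>2 \<ge> b * (- t) * ln L\<close> the subtracted term is at least
  \<open>L powr (k * b - (1 + q))\<close>, which tends to infinity as \<open>t\<close> increases to \<open>0\<close>.  Hence the
  barrier is nonpositive there close to the origin.  Away from the origin it is bounded above and
  \<open>- t\<close> is bounded below, so a large \<open>K\<close> suffices.\<close>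

lemma petrovsky_barrier_boundary_bound:
  fixes c q G k b :: real
  assumes "0 < c" "c < 1" "0 < q" "0 \<le> G" "0 < k" and \<epsilon>: "(1 + q) < k * b"
  obtains K where "0 \<le> K"
    "\<And>(x :: real ^ 'n) t. - c \<le> t \<Longrightarrow> t < 0 \<Longrightarrow> t = - c \<or> b * (- t) * ln \<bar>ln \<bar>t\<bar>\<bar> \<le> (norm x)\<^sup>2 \<Longrightarrow>
      petrovsky_barrier q k G (x, t) \<le> K * - t"
proof -
  define r where "r = k * b - (1 + q)"
  have "r > 0" using \<epsilon> by (simp add: r_def)
  define L1 where "L1 = (1 + G) powr (1 / r)"
  have "L1 \<ge> 1" using \<open>r > 0\<close> \<open>0 \<le> G\<close> by (simp add: L1_def ge_one_powr_ge_zero)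
  define W where "W = 1 + G * (- ln c) powr - q"
  have "W > 0" using \<open>0 \<le> G\<close> by (simp add: W_def add_pos_nonneg)
  define K where "K = W * (exp L1 + 1 / c)"
  have "0 \<le> K" using \<open>W > 0\<close> \<open>0 < c\<close> by (simp add: K_def)
  moreover have "petrovsky_barrier q k G (x, t) \<le> K * - t"
    if t: "- c \<le> t" "t < 0" and bdry: "t = - c \<or> b * (- t) * ln \<bar>ln \<bar>t\<bar>\<bar> \<le> (norm x)\<^sup>2"
    for x :: "real ^ 'n" and t
  proof -
    define L where "L = - ln (- t)"
    have t_L: "- t = exp (- L)" using t by (simp add: L_def)
    have "- ln c \<le> L" using t \<open>0 < c\<close> by (simp add: L_def)
    have "0 < - ln c" using assms by (simp add: ln_less_zero)
    then have "L > 0" using \<open>- ln c \<le> L\<close> by simp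
    have "L powr - q \<le> (- ln c) powr - q"
      using \<open>- ln c \<le> L\<close> \<open>0 < - ln c\<close> \<open>0 < q\<close> by (intro powr_mono2') auto
    then have "1 + G * L powr - q \<le> W"
      unfolding W_def using \<open>0 \<le> G\<close> by (simp add: mult_left_mono)
    then have w: "petrovsky_barrier q k G (x, t) \<le> W"
      unfolding petrovsky_barrier_def fst_conv snd_conv L_def[symmetric]
      by (smt (verit) exp_ge_zero mult_nonneg_nonneg powr_ge_zero)
    consider "t = - c" | "L < L1" | "L1 \<le> L" "b * (- t) * ln \<bar>ln \<bar>t\<bar>\<bar> \<le> (norm x)\<^sup>2"
      using bdry by linarith
    then show ?thesis
    proof cases
      case 1
      have "W \<le> W * (exp L1 + 1 / c) * c"
        using \<open>W > 0\<close> \<open>0 < c\<close> by (simp add: distrib_left distrib_right)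
      then show ?thesis using w 1 by (simp add: K_def)
    next
      case 2
      have "1 \<le> exp L1 * exp (- L)" using 2 by (simp add: exp_add[symmetric])
      also have "\<dots> \<le> (exp L1 + 1 / c) * exp (- L)"
        using \<open>0 < c\<close> by (intro mult_right_mono) auto
      finally have "W * 1 \<le> W * ((exp L1 + 1 / c) * exp (- L))"
        using \<open>W > 0\<close> by (intro mult_left_mono) auto
      then show ?thesis using w unfolding K_def t_L by (simp add: mult.assoc)
    next
      case 3
      have abs: "\<bar>ln \<bar>t\<bar>\<bar> = L" using t \<open>L > 0\<close> by (simp add: L_def)
      have "k * b * ln L \<le> k / - t * (norm x)\<^sup>2"
      proof -
        have "b * ln L \<le> (norm x)\<^sup>2 / - t"
          using 3(2) t unfolding abs by (subst pos_le_divide_eq) (simp_all add: mult_ac)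
        then have "k * (b * ln L) \<le> k * ((norm x)\<^sup>2 / - t)"
          using \<open>0 < k\<close> by (intro mult_left_mono) auto
        then show ?thesis by simp
      qed
      then have "exp (k * b * ln L) \<le> exp (k / - t * (x \<bullet> x))"
        by (simp add: power2_norm_eq_inner)
      then have "L powr (k * b) \<le> exp (k / - t * (x \<bullet> x))"
        using \<open>L > 0\<close> by (simp add: powr_def)
      then have "L powr - (1 + q) * L powr (k * b) \<le> L powr - (1 + q) * exp (k / - t * (x \<bullet> x))"
        by (intro mult_left_mono) auto
      moreover have "r = - (1 + q) + k * b" by (simp add: r_def)
      ultimately have 4: "L powr r \<le> L powr - (1 + q) * exp (k / - t * (x \<bullet> x))"
        by (simp only: powr_add)
      have "1 + G = L1 powr r" using \<open>r > 0\<close> \<open>0 \<le> G\<close> by (simp add: L1_def powr_powr)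
      also have "\<dots> \<le> L powr r" using 3(1) \<open>L1 \<ge> 1\<close> \<open>r > 0\<close> by (intro powr_mono2) auto
      finally have 5: "1 + G \<le> L powr r" .
      have "L powr - q \<le> 1 powr - q"
        using 3(1) \<open>L1 \<ge> 1\<close> \<open>0 < q\<close> by (intro powr_mono2') auto
      then have "G * L powr - q \<le> G" using \<open>0 \<le> G\<close> by (simp add: mult_left_le)
      then have "petrovsky_barrier q k G (x, t) \<le> 0"
        unfolding petrovsky_barrier_def fst_conv snd_conv L_def[symmetric] using 4 5 by simp
      also have "0 \<le> K * - t" using \<open>0 \<le> K\<close> t by (intro mult_nonneg_nonneg) auto
      finally show ?thesis .
    qed
  qed
  ultimately show thesis by (rule that)
qed

section \<open>The domain and its irregular boundary point\<close>

lemma iterated_log_region_open: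
  fixes r c :: real
  assumes "c < 1"
  shows "open {(x :: real ^ 'n, t). - c < t \<and> t < 0 \<and> (norm x)\<^sup>2 < - r * t * ln \<bar>ln \<bar>t\<bar>\<bar>}"
proof -
  let ?B = "{z :: (real ^ 'n) \<times> real. - c < snd z \<and> snd z < 0}"
  let ?g = "\<lambda>z :: (real ^ 'n) \<times> real. - r * snd z * ln \<bar>ln \<bar>snd z\<bar>\<bar> - (norm (fst z))\<^sup>2"
  have "open ?B"
    unfolding Collect_conj_eq by (intro open_Int open_Collect_less continuous_intros)
  moreover have "continuous_on ?B ?g"
    using assms by (intro continuous_intros) (auto simp: ln_eq_zero_iff)
  ultimately have "open (?g -` {0<..} \<inter> ?B)"
    using continuous_on_open_vimage[of ?B ?g] open_greaterThan[of "0 :: real"] by blast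
  also have "?g -` {0<..} \<inter> ?B
      = {(x :: real ^ 'n, t). - c < t \<and> t < 0 \<and> (norm x)\<^sup>2 < - r * t * ln \<bar>ln \<bar>t\<bar>\<bar>}"
    by auto
  finally show ?thesis .
qed

text \<open>Write \<open>s = - t\<close>.  The inequality \<open>ln y \<le> y - 1\<close>, used twice, gives \<open>ln (ln (1 / s)) \<le> 1 / s\<close>.\<close>

lemma iterated_log_region_bounded:
  fixes r t :: real
  assumes "0 < r" "- 1 < t" "t < 0"
  shows "- r * t * ln \<bar>ln \<bar>t\<bar>\<bar> \<le> r"
proof -
  define s where "s = - t"
  have s: "0 < s" "s < 1" using assms by (auto simp: s_def)
  then have "0 < - ln s" by simp
  then have "ln (- ln s) \<le> - ln s" using ln_le_minus_one[of "- ln s"] by linarith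
  also have "\<dots> = ln (1 / s)" using s by (simp add: ln_div)
  also have "\<dots> \<le> 1 / s" using s ln_le_minus_one[of "1 / s"] by simp
  finally have "r * s * ln (- ln s) \<le> r * s * (1 / s)"
    using s \<open>0 < r\<close> by (intro mult_left_mono) auto
  then show ?thesis using s \<open>0 < - ln s\<close> by (simp add: s_def)
qed

lemma petrovsky_barrier_axis_ge:
  assumes "0 \<le> G" "0 < q" "0 < s" "s \<le> exp (- 2)"
  shows "1 / 2 \<le> petrovsky_barrier q k G (0 :: real ^ 'n, - s)"
proof -
  define L where "L = - ln s"
  have "ln s \<le> ln (exp (- 2))" using assms by (subst ln_le_cancel_iff) auto
  then have "2 \<le> L" by (simp add: L_def)
  have "L powr - (1 + q) \<le> L powr - 1"
    using \<open>2 \<le> L\<close> \<open>0 < q\<close> by (intro powr_mono) auto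
  also have "\<dots> \<le> 1 / 2"
    using \<open>2 \<le> L\<close> by (simp add: powr_minus field_simps)
  finally have "L powr - (1 + q) \<le> 1 / 2" .
  moreover have "0 \<le> G * L powr - q" using \<open>0 \<le> G\<close> by simp
  moreover have "petrovsky_barrier q k G (0 :: real ^ 'n, - s) = 1 + G * L powr - q - L powr - (1 + q)"
    by (simp add: petrovsky_barrier_def L_def)
  ultimately show ?thesis by linarith
qed

theorem theorem1p3:
  fixes p \<beta> c \<epsilon> :: real and \<Omega> :: "((real ^ 'n) \<times> real) set"
  assumes "1 < p"
    and "\<beta> = 4 * ((p - 1) / p)"
    and "0 < c" and "c < 1"
    and "\<epsilon> > 0"
    and "\<Omega> = {(x, t). - c < t \<and> t < 0 \<and>
               (norm x)\<^sup>2 < - \<beta> * (1 + \<epsilon>) * t * ln \<bar>ln \<bar>t\<bar>\<bar>}"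
  shows "(0, 0) \<in> frontier \<Omega> \<and> \<not> regular_point p \<Omega> (0, 0)"
proof -
  define b where "b = \<beta> * (1 + \<epsilon>)"
  have "\<beta> > 0" using assms(1,2) by simp
  then have "b > 0" using \<open>\<epsilon> > 0\<close> by (simp add: b_def)
  have \<Omega>: "\<Omega> = {(x, t). - c < t \<and> t < 0 \<and> (norm x)\<^sup>2 < - b * t * ln \<bar>ln \<bar>t\<bar>\<bar>}"
    unfolding assms(6) b_def by simp
  have "open \<Omega>" unfolding \<Omega> by (rule iterated_log_region_open[OF \<open>c < 1\<close>])
  have snd_\<Omega>: "- c < snd z \<and> snd z < 0" if "z \<in> \<Omega>" for z
    using that by (auto simp: \<Omega>)
  have fst_\<Omega>: "norm (fst z) \<le> sqrt b" if "z \<in> \<Omega>" for z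
    using that iterated_log_region_bounded[OF \<open>0 < b\<close>, of "snd z"] \<open>c < 1\<close>
    by (intro real_le_rsqrt) (auto simp: \<Omega>)
  have axis: "(0, - s) \<in> \<Omega>" if "0 < s" "s < c" "s \<le> exp (- 2)" for s
  proof -
    have "ln s \<le> ln (exp (- 2))" using that by (subst ln_le_cancel_iff) auto
    then have "0 < ln \<bar>ln s\<bar>" by simp
    then have "0 < b * s * ln \<bar>ln s\<bar>" using \<open>0 < b\<close> that by simp
    then show ?thesis using that by (simp add: \<Omega>)
  qed
  have near: "\<exists>s. 0 < s \<and> s < d \<and> s < c \<and> s \<le> exp (- 2)" if "0 < d" for d
  proof -
    have "0 < min d (min c (exp (- 2)))" using that \<open>0 < c\<close> by simp
    then show ?thesis by (metis dense min_less_iff_conj less_imp_le)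
  qed
  have "(0, 0) \<in> closure \<Omega>"
    unfolding closure_approachable
  proof (intro allI impI)
    fix d :: real assume "0 < d"
    then obtain s where "0 < s" "s < d" "s < c" "s \<le> exp (- 2)" using near by blast
    then show "\<exists>y\<in>\<Omega>. dist y (0, 0) < d"
      using axis by (intro bexI[of _ "(0, - s)"]) (auto simp: dist_Pair_Pair)
  qed
  moreover have "(0, 0) \<notin> \<Omega>" by (simp add: \<Omega>)
  ultimately have origin: "(0, 0) \<in> frontier \<Omega>"
    using \<open>open \<Omega>\<close> by (simp add: frontier_def interior_open)

  have closure_\<Omega>: "- c \<le> snd z \<and> snd z \<le> 0" if "z \<in> closure \<Omega>" for z
  proof -
    have "closed {z :: (real ^ 'n) \<times> real. - c \<le> snd z \<and> snd z \<le> 0}"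
      unfolding Collect_conj_eq by (intro closed_Int closed_Collect_le continuous_intros)
    then have "closure \<Omega> \<subseteq> {z. - c \<le> snd z \<and> snd z \<le> 0}"
      by (rule closure_minimal[rotated]) (use snd_\<Omega> in force)
    then show ?thesis using that by blast
  qed

  \<comment> \<open>Both the loss in the diffusion constant and the extra power of the logarithm cost a factor
    \<open>1 + q\<close>; together they must stay below the available factor \<open>1 + \<epsilon>\<close>.\<close>
  define q where "q = sqrt (1 + \<epsilon> / 2) - 1"
  have "0 < q" using \<open>\<epsilon> > 0\<close> by (simp add: q_def)
  have q2: "(1 + q)\<^sup>2 < 1 + \<epsilon>" using \<open>\<epsilon> > 0\<close> by (simp add: q_def)
  define k where "k = p / (4 * (p - 1) * (1 + q))"
  have "0 < k" using \<open>1 < p\<close> \<open>0 < q\<close> by (simp add: k_def)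
  have kb: "1 + q < k * b"
  proof -
    have "k * b = (1 + \<epsilon>) / (1 + q)"
      unfolding k_def b_def assms(2) using \<open>1 < p\<close> \<open>0 < q\<close> by (simp add: divide_simps)
    then show ?thesis using q2 \<open>0 < q\<close> by (simp add: pos_less_divide_eq power2_eq_square)
  qed
  define C where "C = (1 + q) / - ln c + 2 * k * (real CARD('n) + p - 2) / p"
  define G where "G = C * exp (C / (q / (1 + q))) / q"
  have "real CARD('n) \<ge> 1" by (simp add: Suc_leI)
  then have "0 \<le> real CARD('n) + p - 2" using \<open>1 < p\<close> by linarith
  then have "C \<ge> 0" unfolding C_def
    using \<open>0 < k\<close> \<open>1 < p\<close> \<open>0 < q\<close> \<open>0 < c\<close> \<open>c < 1\<close>
    by (intro add_nonneg_nonneg divide_nonneg_nonneg mult_nonneg_nonneg) (auto simp: ln_le_zero_iff)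
  then have "G \<ge> 0" using \<open>0 < q\<close> by (simp add: G_def)
  have G: "C * exp (C / (q / (1 + q))) \<le> q * G" using \<open>0 < q\<close> by (simp add: G_def)
  let ?w = "petrovsky_barrier q k G :: (real ^ 'n) \<times> real \<Rightarrow> real"
  have w_cont: "isCont ?w z" if "- c \<le> snd z" "snd z < 0" for z
  proof -
    have "open {z :: (real ^ 'n) \<times> real. - 1 < snd z \<and> snd z < 0}"
      unfolding Collect_conj_eq by (intro open_Int open_Collect_less continuous_intros)
    then show ?thesis
      by (rule continuous_on_eq_continuous_at[THEN iffD1, rule_format, OF _ petrovsky_barrier_continuous_on])
        (use that \<open>c < 1\<close> in auto)
  qed

  obtain K where "0 \<le> K" and K: "\<And>(x :: real ^ 'n) t. - c \<le> t \<Longrightarrow> t < 0 \<Longrightarrow>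
      t = - c \<or> b * (- t) * ln \<bar>ln \<bar>t\<bar>\<bar> \<le> (norm x)\<^sup>2 \<Longrightarrow> ?w (x, t) \<le> K * - t"
    using petrovsky_barrier_boundary_bound[OF \<open>0 < c\<close> \<open>c < 1\<close> \<open>0 < q\<close> \<open>0 \<le> G\<close> \<open>0 < k\<close> kb] by metis
  \<comment> \<open>These boundary values vanish at the origin and dominate the barrier on the rest of the frontier.\<close>
  define f where "f = (\<lambda>z :: (real ^ 'n) \<times> real. K * - snd z)"
  have "continuous_on (frontier \<Omega>) f" unfolding f_def by (intro continuous_intros)
  have "bounded (f ` frontier \<Omega>)"
  proof (rule boundedI)
    fix y assume "y \<in> f ` frontier \<Omega>"
    then obtain z where "z \<in> closure \<Omega>" "y = f z" by (auto simp: frontier_def)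
    then show "norm y \<le> K * c"
      using closure_\<Omega>[of z] \<open>0 \<le> K\<close> mult_left_mono[of "- snd z" c K]
      by (simp add: f_def abs_mult)
  qed
  have w_f: "?w z \<le> f z" if "z \<in> frontier \<Omega>" "snd z < 0" for z
  proof -
    have "z \<notin> \<Omega>" "- c \<le> snd z"
      using that(1) closure_\<Omega>[of z] \<open>open \<Omega>\<close> by (auto simp: frontier_def interior_open)
    then show ?thesis
      using K[of "snd z" "fst z"] that(2) by (cases z) (force simp: \<Omega> f_def)
  qed

  have perron_ge: "ereal (?w z) \<le> lower_perron p \<Omega> f z" if "z \<in> \<Omega>" for z
  proof -
    \<comment> \<open>Cutting at the time of \<open>z\<close> itself keeps the value at \<open>z\<close>; cutting to a level below the
      minimum of the barrier up to that time keeps upper semicontinuity.\<close>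
    define T where "T = snd z"
    have "T < 0" using snd_\<Omega>[OF that] by (simp add: T_def)
    let ?Q = "cball (0 :: real ^ 'n) (sqrt b) \<times> {- c..T}"
    have "continuous_on ?Q ?w"
      using w_cont \<open>T < 0\<close> by (intro continuous_at_imp_continuous_on) auto
    then have "bounded (?w ` ?Q)"
      by (intro compact_imp_bounded compact_continuous_image compact_Times compact_cball compact_Icc)
    then obtain M where "0 < M" and M: "\<And>y. y \<in> ?Q \<Longrightarrow> \<bar>?w y\<bar> \<le> M"
      unfolding bounded_pos by auto
    define v where "v = cut_after T (- (M + 1)) ?w"
    have "viscosity_subsolution p \<Omega> v"
      unfolding v_def
    proof (rule cut_barrier_subsolution[OF \<open>1 < p\<close> \<open>0 < c\<close> \<open>c < 1\<close> \<open>0 < q\<close> k_def C_def G \<open>open \<Omega>\<close> snd_\<Omega>])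
      show "\<bar>?w y\<bar> < M + 1" if "y \<in> \<Omega>" "snd y \<le> T" for y
        using M[of y] snd_\<Omega>[OF that(1)] fst_\<Omega>[OF that(1)] that(2) by (cases y) fastforce
      show "0 \<le> M + 1" using \<open>0 < M\<close> by linarith
    qed
    moreover have "Limsup (at y within \<Omega>) (\<lambda>\<eta>. ereal (v \<eta>)) \<le> ereal (f y)" if "y \<in> frontier \<Omega>" for y
      unfolding Limsup_le_iff
    proof (intro allI impI)
      fix a assume a: "ereal (f y) < a"
      have "- c \<le> snd y" "snd y \<le> 0" using closure_\<Omega>[of y] that by (auto simp: frontier_def)
      have "f y \<ge> 0" using \<open>snd y \<le> 0\<close> \<open>0 \<le> K\<close> by (simp add: f_def mult_nonneg_nonpos)
      show "\<forall>\<^sub>F \<eta> in at y within \<Omega>. ereal (v \<eta>) < a"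
      proof (cases a)
        case (real r)
        have "\<forall>\<^sub>F \<eta> in at y within \<Omega>. v \<eta> < r"
          unfolding v_def
        proof (rule cut_after_eventually_less)
          show "isCont ?w y \<and> ?w y < r" if "snd y \<le> T"
            using that \<open>T < 0\<close> \<open>- c \<le> snd y\<close> w_cont[of y] w_f[OF \<open>y \<in> frontier \<Omega>\<close>] a real by auto
          show "- (M + 1) < r" using a real \<open>f y \<ge> 0\<close> \<open>0 < M\<close> by simp
        qed
        then show ?thesis using real by simp
      qed (use a in auto)
    qed
    ultimately have "v \<in> lower_class p \<Omega> f" by (simp add: lower_class_def)
    then have "ereal (v z) \<le> lower_perron p \<Omega> f z"
      unfolding lower_perron_def by (rule SUP_upper)
    then show ?thesis by (simp add: v_def cut_after_def T_def)
  qed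

  have "\<not> regular_point p \<Omega> (0, 0)"
  proof
    assume "regular_point p \<Omega> (0, 0)"
    then have "(lower_perron p \<Omega> f \<longlongrightarrow> ereal (f (0, 0))) (at (0, 0) within \<Omega>)"
      using \<open>continuous_on (frontier \<Omega>) f\<close> \<open>bounded (f ` frontier \<Omega>)\<close>
      by (simp add: regular_point_def)
    then have "\<forall>\<^sub>F z in at (0, 0) within \<Omega>. lower_perron p \<Omega> f z < ereal (1 / 2)"
      by (rule order_tendstoD) (simp add: f_def)
    then obtain d where "d > 0"
      and d: "\<And>z. z \<in> \<Omega> \<Longrightarrow> z \<noteq> (0, 0) \<Longrightarrow> dist z (0, 0) < d \<Longrightarrow> lower_perron p \<Omega> f z < ereal (1 / 2)"
      unfolding eventually_at by blast
    obtain s where s: "0 < s" "s < d" "s < c" "s \<le> exp (- 2)" using near[OF \<open>d > 0\<close>] by blast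
    have "lower_perron p \<Omega> f (0, - s) < ereal (1 / 2)"
      by (rule d[OF axis]) (use s in \<open>auto simp: dist_Pair_Pair\<close>)
    moreover have "ereal (1 / 2) \<le> lower_perron p \<Omega> f (0, - s)"
      using petrovsky_barrier_axis_ge[OF \<open>0 \<le> G\<close> \<open>0 < q\<close> s(1,4)] perron_ge[OF axis[OF s(1,3,4)]]
      by (meson ereal_less_eq(3) order_trans)
    ultimately show False by simp
  qed
  with origin show ?thesis by blast
qed

end
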